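(* Let $\Sigma$: $\dot x=f(x)$ be a dynamical system on an $n$-dimensional manifold $\mathcal{X}$ with flow $\psi^t$. Suppose that $\Sigma$ admits Koopman eigenfunctions $\phi_{\lambda_j}\in C^1(\mathcal{X})$ with eigenvalues $\lambda_j\in\mathbb{C}$, $j=1,\dots,n$, with $\Re\{\lambda_1\}\geq \Re\{\lambda_j\}$ for all $j$, such that the linear map $\partial\Phi(x):T_x\mathcal{X}\to\mathbb{C}^n$, $$\partial\Phi(x)\delta x=(\partial\phi_{\lambda_1}(x)\delta x,\dots,\partial\phi_{\lambda_n}(x)\delta x),$$ is injective for all $x\in\mathcal{X}$. Then $\Sigma$ is differentially positive if one of the following is satisfied: 1) $\lambda_1\in\mathbb{R}$ (with $\phi_{\lambda_1}$ real-valued). In this case the cone field is $$\mathcal{K}(x)=\left\{\delta x\in T_x\mathcal{X}\ :\ \partial\phi_{\lambda_1}(x)\delta x-|\partial\phi_{\lambda_j}(x)\delta x|\geq 0\ \ \forall j\geq 2\right\}.$$ 2) $\lambda_1\in i\mathbb{R}$, with $\angle\phi_{\lambda_1}\in C^1(\mathcal{X})$ and $|\phi_{\lambda_1}|$ constant on $\mathcal{X}$. In this case the cone field is $$\mathcal{K}(x)=\left\{\delta x\in T_x\mathcal{X}\ :\ \partial\angle\phi_{\lambda_1}(x)\delta x-|\partial\phi_{\lambda_j}(x)\delta x|\geq 0\ \ \forall j\geq 2\right\}.$$ In either case, the system is strictly differentially positive (with respect to the corresponding cone field) if $\Re\{\lambda_1\}>\Re\{\lambda_j\}$ for all $j\geq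 2$.
   Context: Setting. $\mathcal{X}$ is a smooth $n$-dimensional manifold with a Riemannian metric $\langle\cdot,\cdot\rangle_x$, and $|\delta x|=\sqrt{\langle\delta x,\delta x\rangle_x}$ for $\delta x\in T_x\mathcal{X}$. The system $\Sigma$ is $\dot x=f(x)$ with $f$ a vector field of class $C^2$ on $\mathcal{X}$, forward and backward complete, so that its flow $\psi:\mathbb{R}\times\mathcal{X}\to\mathcal{X}$, $\psi^t(\cdot)=\psi(t,\cdot)$, is defined for all $t\in\mathbb{R}$. For a differentiable map $g$, $\partial g(x)\delta x=\partial g(x)[\delta x]$ is its differential at $x$ applied to $\delta x\in T_x\mathcal{X}$, and $\partial g(x)A=\{\partial g(x)\delta x:\delta x\in A\}$ for $A\subseteq T_x\mathcal{X}$. Koopman eigenfunctions. The Koopman operators act on observables $g:\mathcal{X}\to\mathbb{C}$ by $U^tg=g\circ\psi^t$, $t\in\mathbb{R}$. An observable $\phi_\lambda$ is a Koopman eigenfunction with eigenvalue $\lambda\in\mathbb{C}$ if $\phi_\lambda(\psi^t(x))=e^{\lambda t}\phi_\lambda(x)$ for all $x\in\mathcal{X}$ (and all $t$). $\angle\phi_{\lambda_1}$ denotes the argument of $\phi_{\lambda_1}$ (so $\phi_{\lambda_1}=|\phi_{\lambda_1}|e^{i\angle\phi_{\lambda_1}}$), regarded as taking values in the circle $\mathbb{S}^1=\mathbb{R}/2\pi\mathbb{Z}$; its differential is real-valued. Cone fields. A cone field assigns to each $x\in\mathcal{X}$ a closed, solid (nonempty interior) set $\mathcal{K}(x)\subseteq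 T_x\mathcal{X}$ with $\mathcal{K}(x)+\mathcal{K}(x)\subseteq\mathcal{K}(x)$, $\alpha\mathcal{K}(x)\subseteq\mathcal{K}(x)$ for all $\alpha\in\mathbb{R}^+$, and $\mathcal{K}(x)\cap-\mathcal{K}(x)=\{0\}$. Differential positivity. $\Sigma$ is differentially positive (with respect to $\mathcal{K}$) if $\partial\psi^t(x)\mathcal{K}(x)\subseteq\mathcal{K}(\psi^t(x))$ for all $x\in\mathcal{X}$ and $t>0$. It is (uniformly) strictly differentially positive if in addition there exist a constant $T>0$ and a cone field $\mathcal{R}(x)\subset\mathrm{int}\,\mathcal{K}(x)\cup\{0\}$ such that $\partial\psi^t(x)\mathcal{K}(x)\subseteq\mathcal{R}(\psi^t(x))$ for all $x\in\mathcal{X}$ and $t\geq T$. Standing conventions on cone fields in the paper: to avoid pathological cases, it is assumed that for every $x_1,x_2\in\mathcal{X}$ there is a linear invertible map $\Gamma(x_1,x_2):T_{x_1}\mathcal{X}\to T_{x_2}\mathcal{X}$ with $\Gamma(x_1,x_2)\mathcal{K}(x_1)=\mathcal{K}(x_2)$ and $\Gamma(x_1,x_2)\mathcal{R}(x_1)=\mathcal{R}(x_2)$; and one considers representations $\mathcal{K}(x)=\{\delta x: k_i(x,\delta x)\geq 0,\ i=1,\dots,m\}$, $\mathcal{R}(x)=\{\delta x: k_i(x,\delta x/|\delta x|)\geq\varepsilon,\ i=1,\dots,m\}$ for some $m\in\mathbb{N}$, $\varepsilon>0$ and smooth functions $k_i:T\mathcal{X}\to\mathbb{R}$.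
   Formalization: Assumes n ≥ 2 and that each K(x) has nonempty interior; otherwise false: for f=0 on R², φ₁=x, φ₂=y+5ix, λ₁=λ₂=0, K(x)={0}; for n=1, K(x) is the whole tangent line, which is not pointed. *)

theory Defs
  imports "HOL-Analysis.Analysis" "HOL-Library.Function_Algebras"
begin

instantiation "fun" :: (type, real_vector) real_vector
begin

definition scaleR_fun :: "real \<Rightarrow> ('a \<Rightarrow> 'b) \<Rightarrow> 'a \<Rightarrow> 'b"
  where "scaleR_fun a f = (\<lambda>x. a *\<^sub>R f x)"

instance
  by standard (simp_all add: scaleR_fun_def fun_eq_iff scaleR_add_right scaleR_add_left)

end

primrec Ck_on ::
  "nat \<Rightarrow> ('e::real_normed_vector \<Rightarrow> 'b::real_normed_vector) \<Rightarrow> 'e set \<Rightarrow> bool"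
where
  "Ck_on 0 f S = continuous_on S f"
| "Ck_on (Suc k) f S =
     ((\<forall>x\<in>S. f differentiable (at x)) \<and>
      (\<forall>v. Ck_on k (\<lambda>x. frechet_derivative f (at x) v) S))"

definition smooth_on ::
  "('e::real_normed_vector \<Rightarrow> 'b::real_normed_vector) \<Rightarrow> 'e set \<Rightarrow> bool"
  where "smooth_on f S \<longleftrightarrow> (\<forall>k. Ck_on k f S)"

text \<open>A manifold of dimension \<^term>\<open>CARD('n)\<close> is a whole type \<^typ>\<open>'a\<close> with an atlas.
  A chart is a pair of its domain and its coordinate map; the values of the
  coordinate map outside the domain are irrelevant.\<close>

type_synonym ('a, 'n) chart = "'a set \<times> ('a \<Rightarrow> real^'n)"

definition chart_inv :: "('a, 'n) chart \<Rightarrow> real^'n \<Rightarrow> 'a"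
  where "chart_inv c = inv_into (fst c) (snd c)"

definition charts_at :: "('a, 'n) chart set \<Rightarrow> 'a \<Rightarrow> ('a, 'n) chart set"
  where "charts_at A x = {c \<in> A. x \<in> fst c}"

definition smooth_manifold ::
  "('a::{t2_space, second_countable_topology}, 'n::finite) chart set \<Rightarrow> bool"
where
  "smooth_manifold A \<longleftrightarrow>
     (\<forall>c\<in>A. open (fst c) \<and> open (snd c ` fst c) \<and>
            homeomorphism (fst c) (snd c ` fst c) (snd c) (chart_inv c)) \<and>
     (\<Union>c\<in>A. fst c) = UNIV \<and>
     (\<forall>c\<in>A. \<forall>d\<in>A. smooth_on (snd d \<circ> chart_inv c) (snd c ` (fst c \<inter> fst d)))"

text \<open>A tangent vector at \<open>x\<close> is the family of its coordinate vectors in all charts around \<open>x\<close>,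
  related by the derivatives of the chart transitions. It is set to \<open>0\<close> at the charts
  whose domain does not contain \<open>x\<close>, so that \<open>tangent_space A x\<close> is a linear subspace of the
  function space. Evaluation at any chart around \<open>x\<close> is a linear homeomorphism onto
  \<^typ>\<open>real^'n\<close>, where the tangent space carries the subspace topology.\<close>

type_synonym ('a, 'n) tvec = "('a, 'n) chart \<Rightarrow> real^'n"

definition transition_deriv ::
  "('a, 'n::finite) chart \<Rightarrow> ('a, 'n) chart \<Rightarrow> 'a \<Rightarrow> real^'n \<Rightarrow> real^'n"
  where "transition_deriv c d x = frechet_derivative (snd d \<circ> chart_inv c) (at (snd c x))"

definition tangent_space :: "('a, 'n::finite) chart set \<Rightarrow> 'a \<Rightarrow> ('a, 'n) tvec set"
where
  "tangent_space A x =
     {v. (\<forall>c. c \<notin> charts_at A x \<longrightarrow> v c = 0) \<and>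
         (\<forall>c\<in>charts_at A x. \<forall>d\<in>charts_at A x. v d = transition_deriv c d x (v c))}"

definition tvec_of ::
  "('a, 'n::finite) chart set \<Rightarrow> ('a, 'n) chart \<Rightarrow> 'a \<Rightarrow> real^'n \<Rightarrow> ('a, 'n) tvec"
where
  "tvec_of A c x u = (\<lambda>d. if d \<in> charts_at A x then transition_deriv c d x u else 0)"

definition tangent_iso ::
  "('a, 'n::finite) chart set \<Rightarrow> 'a \<Rightarrow> 'a \<Rightarrow> (('a, 'n) tvec \<Rightarrow> ('a, 'n) tvec) \<Rightarrow> bool"
where
  "tangent_iso A x y L \<longleftrightarrow>
     bij_betw L (tangent_space A x) (tangent_space A y) \<and>
     (\<forall>v\<in>tangent_space A x. \<forall>w\<in>tangent_space A x. L (v + w) = L v + L w) \<and>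
     (\<forall>a. \<forall>v\<in>tangent_space A x. L (a *\<^sub>R v) = a *\<^sub>R L v)"

definition Ck_fun_on ::
  "('a, 'n::finite) chart set \<Rightarrow> nat \<Rightarrow> 'a set \<Rightarrow> ('a \<Rightarrow> 'b::real_normed_vector) \<Rightarrow> bool"
where
  "Ck_fun_on A k U g \<longleftrightarrow> (\<forall>c\<in>A. Ck_on k (g \<circ> chart_inv c) (snd c ` (fst c \<inter> U)))"

definition some_chart :: "('a, 'n) chart set \<Rightarrow> 'a \<Rightarrow> ('a, 'n) chart"
  where "some_chart A x = (SOME c. c \<in> charts_at A x)"

definition differential ::
  "('a, 'n::finite) chart set \<Rightarrow> ('a \<Rightarrow> 'b::real_normed_vector) \<Rightarrow> 'a \<Rightarrow> ('a, 'n) tvec \<Rightarrow> 'b"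
where
  "differential A g x v =
     (let c = some_chart A x
      in frechet_derivative (g \<circ> chart_inv c) (at (snd c x)) (v c))"

definition tangent_map ::
  "('a, 'n::finite) chart set \<Rightarrow> ('a \<Rightarrow> 'a) \<Rightarrow> 'a \<Rightarrow> ('a, 'n) tvec \<Rightarrow> ('a, 'n) tvec"
where
  "tangent_map A g x v =
     (\<lambda>d. if d \<in> charts_at A (g x)
          then let c = some_chart A x
               in frechet_derivative (snd d \<circ> g \<circ> chart_inv c) (at (snd c x)) (v c)
          else 0)"

definition riemannian_metric ::
  "('a, 'n::finite) chart set \<Rightarrow> ('a \<Rightarrow> ('a, 'n) tvec \<Rightarrow> ('a, 'n) tvec \<Rightarrow> real) \<Rightarrow> bool"
where
  "riemannian_metric A m \<longleftrightarrow>
     (\<forall>x. \<forall>u\<in>tangent_space A x. \<forall>v\<in>tangent_space A x. \<forall>w\<in>tangent_space A x. \<forall>a b.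
        m x u v = m x v u \<and>
        m x (a *\<^sub>R u + b *\<^sub>R v) w = a * m x u w + b * m x v w \<and>
        (u \<noteq> 0 \<longrightarrow> m x u u > 0)) \<and>
     (\<forall>c\<in>A. \<forall>u v. smooth_on
        (\<lambda>z. m (chart_inv c z) (tvec_of A c (chart_inv c z) u) (tvec_of A c (chart_inv c z) v))
        (snd c ` fst c))"

definition Ck_vector_field ::
  "('a, 'n::finite) chart set \<Rightarrow> nat \<Rightarrow> ('a \<Rightarrow> ('a, 'n) tvec) \<Rightarrow> bool"
where
  "Ck_vector_field A k f \<longleftrightarrow>
     (\<forall>x. f x \<in> tangent_space A x) \<and>
     (\<forall>c\<in>A. Ck_on k (\<lambda>z. f (chart_inv c z) c) (snd c ` fst c))"

text \<open>The existence of a map \<open>\<psi>\<close> with this property, defined for all real times, is forward and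
  backward completeness of \<open>f\<close>. Continuity of the trajectories has to be required because a
  coordinate map says nothing about points outside its domain.\<close>

definition complete_flow ::
  "('a::topological_space, 'n::finite) chart set \<Rightarrow> ('a \<Rightarrow> ('a, 'n) tvec) \<Rightarrow>
   (real \<Rightarrow> 'a \<Rightarrow> 'a) \<Rightarrow> bool"
where
  "complete_flow A f \<psi> \<longleftrightarrow>
     (\<forall>x. \<psi> 0 x = x \<and>
          continuous_on UNIV (\<lambda>t. \<psi> t x) \<and>
          (\<forall>t. \<forall>c\<in>charts_at A (\<psi> t x).
             ((\<lambda>s. snd c (\<psi> s x)) has_vector_derivative f (\<psi> t x) c) (at t)))"

definition koopman :: "(real \<Rightarrow> 'a \<Rightarrow> 'a) \<Rightarrow> real \<Rightarrow> ('a \<Rightarrow> complex) \<Rightarrow> 'a \<Rightarrow> complex"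
  where "koopman \<psi> t g = g \<circ> \<psi> t"

definition koopman_eigenfunction ::
  "(real \<Rightarrow> 'a \<Rightarrow> 'a) \<Rightarrow> complex \<Rightarrow> ('a \<Rightarrow> complex) \<Rightarrow> bool"
where
  "koopman_eigenfunction \<psi> l g \<longleftrightarrow> (\<forall>t. koopman \<psi> t g = (\<lambda>x. exp (l * of_real t) * g x))"

text \<open>The argument of a nowhere vanishing function takes values in the circle
  \<open>\<real> / 2\<pi>\<int>\<close>, whose charts are the local sections of \<open>\<real> \<rightarrow> \<real> / 2\<pi>\<int>\<close>. It is
  therefore \<open>C\<^sup>1\<close> iff it locally has a real-valued \<open>C\<^sup>1\<close> lift. The differential of the argument
  is that of a local lift; two lifts around a point differ by a locally constant function.\<close>

definition arg_lift ::
  "('a::topological_space, 'n::finite) chart set \<Rightarrow> ('a \<Rightarrow> complex) \<Rightarrow> 'a set \<Rightarrow>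
   ('a \<Rightarrow> real) \<Rightarrow> bool"
where
  "arg_lift A g U \<theta> \<longleftrightarrow>
     open U \<and> Ck_fun_on A 1 U \<theta> \<and> (\<forall>y\<in>U. g y = of_real (cmod (g y)) * cis (\<theta> y))"

definition C1_arg :: "('a::topological_space, 'n::finite) chart set \<Rightarrow> ('a \<Rightarrow> complex) \<Rightarrow> bool"
where
  "C1_arg A g \<longleftrightarrow> (\<forall>x. g x \<noteq> 0) \<and> (\<forall>x. \<exists>U \<theta>. x \<in> U \<and> arg_lift A g U \<theta>)"

definition differential_arg ::
  "('a::topological_space, 'n::finite) chart set \<Rightarrow> ('a \<Rightarrow> complex) \<Rightarrow> 'a \<Rightarrow>
   ('a, 'n) tvec \<Rightarrow> real"
where
  "differential_arg A g x v =
     (THE r. \<exists>U \<theta>. x \<in> U \<and> arg_lift A g U \<theta> \<and> r = differential A \<theta> x v)"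

type_synonym ('a, 'n) cones = "'a \<Rightarrow> ('a, 'n) tvec set"

definition tangent_interior ::
  "('a, 'n::finite) chart set \<Rightarrow> 'a \<Rightarrow> ('a, 'n) tvec set \<Rightarrow> ('a, 'n) tvec set"
  where "tangent_interior A x S = top_of_set (tangent_space A x) interior_of S"

definition solid :: "('a, 'n::finite) chart set \<Rightarrow> ('a, 'n) cones \<Rightarrow> bool"
  where "solid A K \<longleftrightarrow> (\<forall>x. tangent_interior A x (K x) \<noteq> {})"

definition cone_field :: "('a, 'n::finite) chart set \<Rightarrow> ('a, 'n) cones \<Rightarrow> bool"
where
  "cone_field A K \<longleftrightarrow>
     solid A K \<and>
     (\<forall>x. closedin (top_of_set (tangent_space A x)) (K x) \<and>
          (\<forall>v\<in>K x. \<forall>w\<in>K x. v + w \<in> K x) \<and>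
          (\<forall>a>0. \<forall>v\<in>K x. a *\<^sub>R v \<in> K x) \<and>
          K x \<inter> uminus ` K x = {0})"

definition linearly_equivalent_cones ::
  "('a, 'n::finite) chart set \<Rightarrow> ('a, 'n) cones set \<Rightarrow> bool"
where
  "linearly_equivalent_cones A \<C> \<longleftrightarrow>
     (\<forall>x y. \<exists>L. tangent_iso A x y L \<and> (\<forall>K\<in>\<C>. L ` K x = K y))"

definition differentially_positive ::
  "('a, 'n::finite) chart set \<Rightarrow> (real \<Rightarrow> 'a \<Rightarrow> 'a) \<Rightarrow> ('a, 'n) cones \<Rightarrow> bool"
where
  "differentially_positive A \<psi> K \<longleftrightarrow>
     cone_field A K \<and> (\<forall>x. \<forall>t>0. tangent_map A (\<psi> t) x ` K x \<subseteq> K (\<psi> t x))"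

text \<open>The last clause is the regularity convention on pairs of cone fields: whenever the cones
  \<open>K x\<close> are linearly equivalent to each other, \<open>R\<close> is required to be such that the equivalences
  can be chosen to preserve both \<open>K\<close> and \<open>R\<close>.\<close>

definition strictly_differentially_positive ::
  "('a, 'n::finite) chart set \<Rightarrow> (real \<Rightarrow> 'a \<Rightarrow> 'a) \<Rightarrow> ('a, 'n) cones \<Rightarrow> bool"
where
  "strictly_differentially_positive A \<psi> K \<longleftrightarrow>
     differentially_positive A \<psi> K \<and>
     (\<exists>T>0. \<exists>R. cone_field A R \<and>
        (\<forall>x. R x \<subseteq> tangent_interior A x (K x) \<union> {0}) \<and>
        (\<forall>x. \<forall>t\<ge>T. tangent_map A (\<psi> t) x ` K x \<subseteq> R (\<psi> t x)) \<and>
        (linearly_equivalent_cones A {K} \<longrightarrow> linearly_equivalent_cones A {K, R}))"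

text \<open>\<open>real_cone\<close> is meant for a real-valued \<open>\<phi> 1\<close>, whose differential is real; \<open>Re\<close> only converts
  the type.\<close>

definition real_cone ::
  "('a, 'n::finite) chart set \<Rightarrow> (nat \<Rightarrow> 'a \<Rightarrow> complex) \<Rightarrow> ('a, 'n) cones"
where
  "real_cone A \<phi> x =
     {v \<in> tangent_space A x. \<forall>j\<in>{2..CARD('n)}.
        Re (differential A (\<phi> 1) x v) - cmod (differential A (\<phi> j) x v) \<ge> 0}"

definition arg_cone ::
  "('a::topological_space, 'n::finite) chart set \<Rightarrow> (nat \<Rightarrow> 'a \<Rightarrow> complex) \<Rightarrow> ('a, 'n) cones"
where
  "arg_cone A \<phi> x =
     {v \<in> tangent_space A x. \<forall>j\<in>{2..CARD('n)}.
        differential_arg A (\<phi> 1) x v - cmod (differential A (\<phi> j) x v) \<ge> 0}"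

end

theory Submission
  imports Defs
begin

text \<open>Write \<open>b\<^sub>j\<close> for the differential of \<open>\<phi> j\<close> at a point and \<open>a\<close> for the differential of \<open>\<phi> 1\<close>, or of its
argument. Differentiating the eigenfunction equation gives \<open>b\<^sub>j (d\<psi>\<^sup>t v) = exp (\<mu> j * t) * b\<^sub>j v\<close>, and
likewise \<open>a (d\<psi>\<^sup>t v) = exp (r * t) * a v\<close> with \<open>r = Re (\<mu> 1)\<close>. In the coordinates \<open>(a, b\<^sub>j)\<close> the
linearised flow is therefore diagonal, and a cone \<open>|b\<^sub>j| \<le> \<rho> a\<close> is mapped into the cone with \<open>\<rho>\<close>
replaced by \<open>\<rho> exp ((Re (\<mu> j) - r) * t)\<close>. For \<open>\<rho> = 1\<close> this is positivity; if there is a spectral gap,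
the image of the cone lies, for all large times, in the cone \<open>\<R>\<close> with \<open>\<rho> = 1/2\<close>. The rest of the
argument justifies the differentiation and shows that \<open>\<R>\<close> has the required properties.

Differentiability of \<open>\<psi>\<^sup>t\<close> is read off from the eigenfunctions. They form an immersion
\<open>\<Phi>\<close>, which is locally expansive in charts (\<open>eigenfunctions_locally_expansive\<close>), and \<open>\<Phi>\<close> turns the flow
into multiplication by \<open>exp (\<mu> j * t)\<close>. Two continuous curves with the same start and the same image
under \<open>\<Phi>\<close> agree (\<open>lifted_path_unique\<close>), so \<open>\<psi>\<^sup>t\<close> inverts \<open>\<psi>\<^sup>-\<^sup>t\<close>. A trajectory that starts near \<open>x\<close>
cannot leave the neighbourhoods on which \<open>\<Phi>\<close> is expansive, so \<open>\<psi>\<^sup>t\<close> is continuous (\<open>flow_tendsto\<close>); and a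
continuous lift through an immersion of a differentiable map is differentiable
(\<open>has_derivative_of_lift\<close>).

The cone \<open>\<R>\<close> is solid because every tangent space contains a vector with \<open>a = 1\<close> and all
\<open>b\<^sub>j = 0\<close> (\<open>centre_exists\<close>): the cone at \<open>\<psi>\<^sup>-\<^sup>t y\<close> contains a nonzero vector, and pushing it forward to \<open>y\<close>
makes the ratios \<open>|b\<^sub>j| / a\<close> arbitrarily small as \<open>t\<close> grows. With such a centre the cone
\<open>|b\<^sub>j| \<le> a\<close> is the cone over the unit ball of a norm, and the cones \<open>|b\<^sub>j| \<le> \<rho> a\<close> are determined by it
together with its centre and \<open>a\<close>. A linear isomorphism between two cones of this kind need not
respect the centres, as the Lorentz boosts of the light cone show. The point of
\<open>norm_cones_equivalent\<close> is that it can always be corrected by an automorphism of the first cone so as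
to respect them; this gives the compatible equivalences for the pair of cone fields.\<close>

section \<open>Finite families of linear maps\<close>

text \<open>With \<open>D\<^sub>j\<^sup>*\<close> the adjoint, \<open>S = \<Sum>j. D\<^sub>j\<^sup>* D\<^sub>j\<close> satisfies \<open>v \<bullet> S v = \<Sum>j. |D\<^sub>j v|\<^sup>2\<close>. It is therefore
injective, and \<open>M\<^sub>j = S\<^sup>-\<^sup>1 D\<^sub>j\<^sup>*\<close> is the desired family.\<close>

lemma joint_left_inverse:
  fixes D :: "'j \<Rightarrow> 'v::euclidean_space \<Rightarrow> 'w::euclidean_space"
  assumes fin: "finite J" and lin: "\<And>j. j \<in> J \<Longrightarrow> linear (D j)"
    and inj: "\<And>v. (\<And>j. j \<in> J \<Longrightarrow> D j v = 0) \<Longrightarrow> v = 0"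
  obtains M where "\<And>j. j \<in> J \<Longrightarrow> linear (M j)" and "\<And>v. (\<Sum>j\<in>J. M j (D j v)) = v"
proof -
  define S where "S v = (\<Sum>j\<in>J. adjoint (D j) (D j v))" for v
  have linS: "linear S"
    unfolding S_def
    using linear_compose[OF lin adjoint_linear[OF lin]]
    by (intro linear_compose_sum ballI) (simp add: o_def)
  have "v = 0" if "S v = 0" for v
  proof (rule inj)
    fix j assume j: "j \<in> J"
    have "(\<Sum>j\<in>J. D j v \<bullet> D j v) = v \<bullet> S v"
      unfolding S_def by (simp add: inner_sum_right adjoint_works lin)
    then have "(\<Sum>j\<in>J. D j v \<bullet> D j v) = 0" using that by simp
    then have "D j v \<bullet> D j v = 0"
      using j fin by (subst (asm) sum_nonneg_eq_0_iff) auto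
    then show "D j v = 0" by simp
  qed
  then have "inj S" by (simp add: linear_injective_0[OF linS])
  then obtain N where N: "linear N" "N \<circ> S = id"
    using linear_injective_left_inverse[OF linS] by blast
  show thesis
  proof (rule that[of "\<lambda>j w. N (adjoint (D j) w)"])
    show "linear (\<lambda>w. N (adjoint (D j) w))" if "j \<in> J" for j
      using linear_compose[OF adjoint_linear[OF lin[OF that]] N(1)] by (simp add: o_def)
    show "(\<Sum>j\<in>J. N (adjoint (D j) (D j v))) = v" for v
      using N(2) by (simp add: S_def linear_sum[OF N(1)] fun_eq_iff)
  qed
qed

section \<open>Linear equivalence of cones over centrally symmetric bodies\<close>

text \<open>The slice \<open>a = 1\<close> of the cone \<open>|b\<^sub>j v| \<le> a v\<close> is a convex body symmetric about the centre \<open>v\<^sub>0\<close>: it is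
\<open>v\<^sub>0\<close> plus the unit ball of the norm \<open>max\<^sub>j |b\<^sub>j|\<close> on the kernel of \<open>a\<close>.\<close>

locale norm_cone =
  fixes a :: "'v::real_vector \<Rightarrow> real" and b :: "'j \<Rightarrow> 'v \<Rightarrow> complex" and J :: "'j set" and v\<^sub>0 :: 'v
  assumes lin_a: "linear a" and lin_b: "\<And>j. j \<in> J \<Longrightarrow> linear (b j)"
    and fin: "finite J" and nonempty: "J \<noteq> {}"
    and a_centre: "a v\<^sub>0 = 1" and b_centre: "\<And>j. j \<in> J \<Longrightarrow> b j v\<^sub>0 = 0"
    and definite: "\<And>v. a v = 0 \<Longrightarrow> (\<And>j. j \<in> J \<Longrightarrow> b j v = 0) \<Longrightarrow> v = 0"
begin

definition cone :: "real \<Rightarrow> 'v set"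
  where "cone \<rho> = {v. \<forall>j\<in>J. cmod (b j v) \<le> \<rho> * a v}"

lemmas a_simps = linear_add[OF lin_a] linear_diff[OF lin_a] linear_cmul[OF lin_a] linear_neg[OF lin_a]
  linear_0[OF lin_a]
lemmas b_simps = linear_add[OF lin_b] linear_diff[OF lin_b] linear_cmul[OF lin_b] linear_neg[OF lin_b]
  linear_0[OF lin_b]

lemma cone1_iff: "v \<in> cone 1 \<longleftrightarrow> (\<forall>j\<in>J. cmod (b j v) \<le> a v)"
  by (simp add: cone_def)

text \<open>All the cones are recovered from the one with \<open>\<rho> = 1\<close> and the pair \<open>(a, v\<^sub>0)\<close>, so a linear map that
preserves these data preserves every \<open>cone \<rho>\<close>.\<close>

lemma cone_eq_shift: "v \<in> cone \<rho> \<longleftrightarrow> v - ((1 - \<rho>) * a v) *\<^sub>R v\<^sub>0 \<in> cone 1"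
  by (simp add: cone_def a_simps b_simps a_centre b_centre algebra_simps)

lemma a_nonneg: "v \<in> cone 1 \<Longrightarrow> 0 \<le> a v"
  using nonempty order_trans[OF norm_ge_zero] by (auto simp: cone1_iff)

lemma centre_absorbs: "\<exists>M>0. v + M *\<^sub>R v\<^sub>0 \<in> cone 1"
proof -
  define M where "M = (\<Sum>j\<in>J. cmod (b j v)) + \<bar>a v\<bar> + 1"
  have "cmod (b j v) \<le> (\<Sum>j\<in>J. cmod (b j v))" if "j \<in> J" for j
    using fin that by (intro member_le_sum) auto
  then have "cmod (b j v) \<le> a v + M" if "j \<in> J" for j
    using that abs_ge_minus_self[of "a v"] unfolding M_def by (smt (verit))
  then have "v + M *\<^sub>R v\<^sub>0 \<in> cone 1"
    by (simp add: cone1_iff a_simps b_simps a_centre b_centre)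
  moreover have "M > 0" unfolding M_def by (simp add: add_nonneg_pos sum_nonneg)
  ultimately show ?thesis by blast
qed

lemma reflection_in_cone: "v \<in> cone 1 \<Longrightarrow> (2 * a v) *\<^sub>R v\<^sub>0 - v \<in> cone 1"
  by (simp add: cone1_iff a_simps b_simps a_centre b_centre)

lemma centre_in_cone: "v\<^sub>0 \<in> cone 1"
  by (simp add: cone1_iff a_centre b_centre)

lemma cone_add: "v \<in> cone 1 \<Longrightarrow> w \<in> cone 1 \<Longrightarrow> v + w \<in> cone 1"
  by (auto simp: cone1_iff a_simps b_simps intro!: order_trans[OF norm_triangle_ineq] add_mono)

lemma cone_scale: "v \<in> cone 1 \<Longrightarrow> 0 \<le> s \<Longrightarrow> s *\<^sub>R v \<in> cone 1"
  by (auto simp: cone1_iff a_simps b_simps intro!: mult_left_mono)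

text \<open>A second functional \<open>c\<close> with a centre \<open>u\<close> on the same ray as \<open>v\<^sub>0\<close> is proportional to \<open>a\<close>: the two
reflections compose to the shear \<open>v \<mapsto> v + l v *\<^sub>R v\<^sub>0\<close> with \<open>l = 2 (a - \<gamma> c)\<close>, and its iterates would leave
the cone along \<open>- v\<^sub>0\<close> if \<open>l\<close> were negative somewhere on it. Adding a large multiple of \<open>v\<^sub>0\<close> brings any
vector into the cone and does not change \<open>l\<close>, so \<open>l \<ge> 0\<close> everywhere and \<open>l = 0\<close>.\<close>

lemma functional_of_collinear_centre:
  assumes linc: "linear c" and cu: "c u = 1"
    and refl: "\<And>v. v \<in> cone 1 \<Longrightarrow> (2 * c v) *\<^sub>R u - v \<in> cone 1"
    and u: "u = \<gamma> *\<^sub>R v\<^sub>0" and \<gamma>: "\<gamma> > 0"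
  shows "a v = \<gamma> * c v"
proof -
  note c_simps = linear_add[OF linc] linear_diff[OF linc] linear_cmul[OF linc] linear_neg[OF linc]
  have c0: "c v\<^sub>0 = 1 / \<gamma>" using cu u \<gamma> by (simp add: c_simps field_simps)
  define l where "l v = 2 * (a v - \<gamma> * c v)" for v
  have l0: "l v\<^sub>0 = 0" using \<gamma> by (simp add: l_def a_centre c0)
  have l_simps: "l (x + y) = l x + l y" "l (- x) = - l x" "l (s *\<^sub>R x) = s * l x" for x y s
    by (simp_all add: l_def a_simps c_simps algebra_simps)
  have step: "v + l v *\<^sub>R v\<^sub>0 \<in> cone 1" if "v \<in> cone 1" for v
  proof -
    have "(2 * c ((2 * a v) *\<^sub>R v\<^sub>0 - v)) *\<^sub>R u - ((2 * a v) *\<^sub>R v\<^sub>0 - v) \<in> cone 1"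
      by (intro refl reflection_in_cone that)
    moreover have "2 * c ((2 * a v) *\<^sub>R v\<^sub>0 - v) * \<gamma> - 2 * a v = l v"
      using \<gamma> by (simp add: l_def c_simps c0 field_simps)
    then have "(2 * c ((2 * a v) *\<^sub>R v\<^sub>0 - v)) *\<^sub>R u - ((2 * a v) *\<^sub>R v\<^sub>0 - v) = v + l v *\<^sub>R v\<^sub>0"
      unfolding u by (simp add: scaleR_left_diff_distrib flip: \<open>_ = l v\<close>)
    ultimately show ?thesis by simp
  qed
  have iter: "v + (real k * l v) *\<^sub>R v\<^sub>0 \<in> cone 1" if "v \<in> cone 1" for v k
  proof (induction k)
    case (Suc k)
    have "l (v + (real k * l v) *\<^sub>R v\<^sub>0) = l v" by (simp add: l_simps l0)
    with step[OF Suc] show ?case by (simp add: algebra_simps)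
  qed (simp add: that)
  have nonneg: "0 \<le> l v" if "v \<in> cone 1" for v
  proof (rule ccontr)
    assume "\<not> 0 \<le> l v"
    then obtain k where "real k * (- l v) > a v"
      using reals_Archimedean3[of "- l v"] by auto
    moreover have "0 \<le> a v + real k * l v"
      using a_nonneg[OF iter[OF that, of k]] by (simp add: a_simps a_centre)
    ultimately show False by simp
  qed
  have "0 \<le> l v" for v
  proof -
    obtain M where "v + M *\<^sub>R v\<^sub>0 \<in> cone 1" using centre_absorbs by blast
    from nonneg[OF this] show ?thesis by (simp add: l_simps l0)
  qed
  from this[of v] this[of "- v"] have "l v = 0" by (simp add: l_simps)
  then show ?thesis by (simp add: l_def)
qed

end

lemma eventually_power_gt:
  fixes s :: real
  assumes "1 < s"
  shows "\<forall>\<^sub>F k in sequentially. x < s ^ k"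
proof -
  obtain n where n: "x < s ^ n" using real_arch_pow[OF assms] by blast
  have "x < s ^ k" if "n \<le> k" for k
    using n power_increasing[OF that, of s] assms by linarith
  then show ?thesis by (auto simp: eventually_sequentially)
qed

context norm_cone
begin

text \<open>Any two centres of symmetry of the cone are exchanged by a linear automorphism. Here \<open>u\<close> is a second
centre, with functional \<open>c\<close>. If it is not on the ray of \<open>v\<^sub>0\<close>,
let \<open>p, q\<close> span the two extreme rays of the cone in the plane spanned by \<open>v\<^sub>0\<close> and \<open>u\<close>, and write vectors as \<open>P p + Q q + Z\<close> with \<open>Z\<close> annihilated by both \<open>a\<close> and \<open>c\<close>. Both reflections
swap the two rays and negate \<open>Z\<close>, so their product is a boost
\<open>(P, Q, Z) \<mapsto> (\<mu> P, Q / \<mu>, Z)\<close> with \<open>\<mu> > 1\<close>. The boost by \<open>sqrt \<mu>\<close> takes \<open>v\<^sub>0\<close> to a multiple of \<open>u\<close>; what has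
to be shown is that it preserves the cone.

For a general convex cone with infinitely many faces this can fail. Here the cone has finitely many
constraints \<open>|b\<^sub>j v| \<le> a v\<close> of two kinds. If \<open>b\<^sub>j\<close> attains the norm at \<open>w = (p - q) / 2\<close>, invariance under
the powers of the boost by \<open>\<mu>\<close> reduces the constraint to \<open>4 P Q \<ge> y\<^sup>2\<close> and \<open>P, Q \<ge> 0\<close>, where \<open>y\<close> depends on
\<open>Z\<close> only; this is invariant under all boosts. Any other constraint holds automatically, at points with \<open>P > 0\<close>,
after applying a high power of the boost by \<open>\<mu>\<close>, hence follows from the constraints of the first kind.\<close>

lemma centre_exchange:
  assumes linc: "linear c" and cu: "c u = 1" and u_cone: "u \<in> cone 1"
    and u_absorbs: "\<And>v. \<exists>M>0. v + M *\<^sub>R u \<in> cone 1"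
    and refl: "\<And>v. v \<in> cone 1 \<Longrightarrow> (2 * c v) *\<^sub>R u - v \<in> cone 1"
  obtains g \<kappa> where "linear g" "bij g" "g ` cone 1 = cone 1" "\<kappa> \<noteq> 0"
    "g v\<^sub>0 = \<kappa> *\<^sub>R u" "\<And>v. c (g v) = \<kappa> * a v"
proof -
  note c_simps = linear_add[OF linc] linear_diff[OF linc] linear_cmul[OF linc] linear_neg[OF linc]
    linear_0[OF linc]
  define \<gamma> where "\<gamma> = a u"
  have "\<gamma> \<noteq> 0"
  proof
    assume "\<gamma> = 0"
    then have "b j u = 0" if "j \<in> J" for j using u_cone that by (auto simp: cone1_iff \<gamma>_def)
    with \<open>\<gamma> = 0\<close> have "u = 0" by (intro definite) (auto simp: \<gamma>_def)
    then show False using cu by (simp add: c_simps)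
  qed
  then have \<gamma>: "\<gamma> > 0" using a_nonneg[OF u_cone] by (simp add: \<gamma>_def)
  define h where "h = u - \<gamma> *\<^sub>R v\<^sub>0"
  have ah: "a h = 0" by (simp add: h_def a_simps a_centre \<gamma>_def)
  show thesis
  proof (cases "h = 0")
    case True
    then have u: "u = \<gamma> *\<^sub>R v\<^sub>0" by (simp add: h_def)
    have "a v = \<gamma> * c v" for v
      by (rule functional_of_collinear_centre[OF linc cu refl u \<gamma>])
    then show thesis
      using \<gamma> u by (intro that[of id "1 / \<gamma>"]) (simp_all add: linear_id)
  next
    case False
    \<comment> \<open>\<open>r\<close> is the norm of the part \<open>h\<close> of \<open>u\<close> in the kernel of \<open>a\<close>, attained by \<open>b j0\<close>.\<close>
    define r where "r = Max ((\<lambda>j. cmod (b j h)) ` J)"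
    have r_in: "r \<in> (\<lambda>j. cmod (b j h)) ` J"
      unfolding r_def using fin nonempty by (intro Max_in) auto
    then obtain j0 where j0: "j0 \<in> J" "cmod (b j0 h) = r" by auto
    have r_ge: "cmod (b j h) \<le> r" if "j \<in> J" for j
      unfolding r_def using fin that by (intro Max_ge) auto
    have "r \<noteq> 0"
    proof
      assume "r = 0"
      then have "b j h = 0" if "j \<in> J" for j using r_ge[OF that] by simp
      then show False using definite[OF ah] False by blast
    qed
    then have r: "r > 0" using j0 norm_ge_zero[of "b j0 h"] by linarith
    have bu: "b j u = b j h" if "j \<in> J" for j
      using that by (simp add: h_def b_simps b_centre)
    have r\<gamma>: "r < \<gamma>"
    proof -
      obtain M where M: "M > 0" "h + M *\<^sub>R u \<in> cone 1" using u_absorbs by blast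
      have "b j0 (h + M *\<^sub>R u) = (1 + M) *\<^sub>R b j0 h"
        using j0 by (simp add: b_simps bu algebra_simps)
      moreover have "cmod (b j0 (h + M *\<^sub>R u)) \<le> M * \<gamma>"
        using M(2) j0(1) by (auto simp: cone1_iff a_simps ah \<gamma>_def)
      ultimately have "(1 + M) * r \<le> M * \<gamma>" using M(1) j0(2) by simp
      then have "r + M * r \<le> M * \<gamma>" by (simp add: algebra_simps)
      then have "M * r < M * \<gamma>" using r by linarith
      then show ?thesis using M(1) by simp
    qed
    \<comment> \<open>These are the coordinates of \<open>u\<close>: it equals \<open>\<alpha> p + \<beta> q\<close>.\<close>
    define \<alpha> where "\<alpha> = (\<gamma> + r) / 2"
    define \<beta> where "\<beta> = (\<gamma> - r) / 2"
    have \<alpha>\<beta>: "\<alpha> > 0" "\<beta> > 0" "\<alpha> - \<beta> = r" "\<alpha> + \<beta> = \<gamma>" "\<beta> < \<alpha>"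
      using r r\<gamma> \<gamma> by (auto simp: \<alpha>_def \<beta>_def field_simps)
    define w where "w = (1 / r) *\<^sub>R h"
    define p where "p = v\<^sub>0 + w"
    define q where "q = v\<^sub>0 - w"
    have bw: "cmod (b j w) \<le> 1" if "j \<in> J" for j
      using r r_ge[OF that] that by (simp add: w_def b_simps)
    have bw0: "cmod (b j0 w) = 1"
      using r j0 by (simp add: w_def b_simps)
    have aw: "a w = 0" by (simp add: w_def a_simps ah)
    have ap: "a p = 1" and aq: "a q = 1" by (simp_all add: p_def q_def a_simps a_centre aw)
    have bp: "b j p = b j w" and bq: "b j q = - b j w" if "j \<in> J" for j
      using that by (simp_all add: p_def q_def b_simps b_centre)
    have p_cone: "p \<in> cone 1" and q_cone: "q \<in> cone 1"
      by (auto simp: cone1_iff ap aq bp bq bw)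
    have v0: "v\<^sub>0 = (1/2) *\<^sub>R p + (1/2) *\<^sub>R q"
      unfolding p_def q_def by (simp add: algebra_simps flip: scaleR_add_left)
    have u: "u = \<alpha> *\<^sub>R p + \<beta> *\<^sub>R q"
    proof -
      have "\<alpha> *\<^sub>R p + \<beta> *\<^sub>R q = (\<alpha> + \<beta>) *\<^sub>R v\<^sub>0 + (\<alpha> - \<beta>) *\<^sub>R w"
        by (simp add: p_def q_def algebra_simps)
      also have "\<dots> = \<gamma> *\<^sub>R v\<^sub>0 + h" using r by (simp add: \<alpha>\<beta> w_def)
      finally show ?thesis by (simp add: h_def)
    qed
    have plane: "0 \<le> x \<and> 0 \<le> y" if "x *\<^sub>R p + y *\<^sub>R q \<in> cone 1" for x y
    proof -
      have "b j0 (x *\<^sub>R p + y *\<^sub>R q) = (x - y) *\<^sub>R b j0 w"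
        using j0 by (simp add: b_simps bp bq algebra_simps)
      then have "cmod (b j0 (x *\<^sub>R p + y *\<^sub>R q)) = \<bar>x - y\<bar>" by (simp add: bw0)
      then have "\<bar>x - y\<bar> \<le> x + y"
        using that j0(1) by (auto simp: cone1_iff a_simps ap aq)
      then show ?thesis by linarith
    qed
    \<comment> \<open>The reflected rays lie in the cone, which bounds \<open>\<alpha> * c p\<close> and \<open>\<beta> * c q\<close> below by 1/2; as \<open>c u = 1\<close>,
      both bounds are equalities.\<close>
    have "(2 * c p * \<alpha> - 1) *\<^sub>R p + (2 * c p * \<beta>) *\<^sub>R q \<in> cone 1"
      using refl[OF p_cone] unfolding u by (simp add: algebra_simps)
    then have "0 \<le> 2 * c p * \<alpha> - 1" using plane by blast
    moreover have "(2 * c q * \<alpha>) *\<^sub>R p + (2 * c q * \<beta> - 1) *\<^sub>R q \<in> cone 1"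
      using refl[OF q_cone] unfolding u by (simp add: algebra_simps)
    then have "0 \<le> 2 * c q * \<beta> - 1" using plane by blast
    moreover have cpq: "\<alpha> * c p + \<beta> * c q = 1" using cu unfolding u by (simp add: c_simps)
    ultimately have "\<alpha> * c p = 1/2 \<and> \<beta> * c q = 1/2" by (simp add: mult.commute)
    then have cp: "c p = 1 / (2 * \<alpha>)" and cq: "c q = 1 / (2 * \<beta>)" using \<alpha>\<beta> by (simp_all add: field_simps)

    \<comment> \<open>\<open>P\<close> and \<open>Q\<close> solve \<open>P + Q = a\<close> and \<open>P / (2 \<alpha>) + Q / (2 \<beta>) = c\<close>.\<close>
    define P where "P v = \<alpha> * (a v - 2 * \<beta> * c v) / r" for v
    define Q where "Q v = \<beta> * (2 * \<alpha> * c v - a v) / r" for v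
    define Z where "Z v = v - P v *\<^sub>R p - Q v *\<^sub>R q" for v
    have P_lin: "P (x + y) = P x + P y" "P (x - y) = P x - P y" "P (s *\<^sub>R x) = s * P x" for x y s
      by (simp_all add: P_def a_simps c_simps algebra_simps add_divide_distrib diff_divide_distrib)
    have Q_lin: "Q (x + y) = Q x + Q y" "Q (x - y) = Q x - Q y" "Q (s *\<^sub>R x) = s * Q x" for x y s
      by (simp_all add: Q_def a_simps c_simps algebra_simps add_divide_distrib diff_divide_distrib)
    have PQ_basis: "P p = 1" "P q = 0" "Q p = 0" "Q q = 1"
      using \<alpha>\<beta> r by (auto simp: P_def Q_def ap aq cp cq divide_simps algebra_simps simp flip: \<alpha>\<beta>(3))
    have a_PQ: "a v = P v + Q v" for v
    proof -
      have "P v + Q v = (\<alpha> - \<beta>) * a v / r"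
        by (simp add: P_def Q_def add_divide_distrib[symmetric] algebra_simps)
      then show ?thesis using \<alpha>\<beta>(3) r by simp
    qed
    have c_PQ: "c v = P v / (2 * \<alpha>) + Q v / (2 * \<beta>)" for v
    proof -
      have "P v / (2 * \<alpha>) = (a v - 2 * \<beta> * c v) / (2 * r)" "Q v / (2 * \<beta>) = (2 * \<alpha> * c v - a v) / (2 * r)"
        using \<alpha>\<beta>(1,2) by (simp_all add: P_def Q_def)
      then have "P v / (2 * \<alpha>) + Q v / (2 * \<beta>)
          = (a v - 2 * \<beta> * c v) / (2 * r) + (2 * \<alpha> * c v - a v) / (2 * r)" by (simp only:)
      also have "\<dots> = (\<alpha> - \<beta>) * c v / r"
        using r by (simp add: field_simps)
      finally have "P v / (2 * \<alpha>) + Q v / (2 * \<beta>) = (\<alpha> - \<beta>) * c v / r" .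
      then show ?thesis using \<alpha>\<beta>(3) r by simp
    qed
    have Z_lin: "Z (x + y) = Z x + Z y" "Z (x - y) = Z x - Z y" "Z (s *\<^sub>R x) = s *\<^sub>R Z x" for x y s
      by (simp_all add: Z_def P_lin Q_lin algebra_simps)
    have Z_basis: "Z p = 0" "Z q = 0" by (simp_all add: Z_def PQ_basis)
    have PQZ: "P (Z v) = 0" "Q (Z v) = 0" "Z (Z v) = Z v" for v
      by (simp_all add: Z_def P_lin Q_lin PQ_basis)
    have decomp: "v = P v *\<^sub>R p + Q v *\<^sub>R q + Z v" for v by (simp add: Z_def)
    define B where "B s v = (s * P v) *\<^sub>R p + (Q v / s) *\<^sub>R q + Z v" for s v
    have B_PQZ: "P (B s v) = s * P v" "Q (B s v) = Q v / s" "Z (B s v) = Z v" for s v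
      by (simp_all add: B_def P_lin Q_lin Z_lin PQ_basis Z_basis PQZ)
    have B_lin: "linear (B s)" for s
      by (rule linearI) (simp_all add: B_def P_lin Q_lin Z_lin algebra_simps add_divide_distrib)
    have B_comp: "B s (B t v) = B (s * t) v" for s t v
      unfolding B_def[of s "B t v"] B_PQZ by (simp add: B_def ac_simps)
    have B_1: "B 1 v = v" for v using decomp[of v] by (simp add: B_def)
    have refl_PQZ: "(2 * a v) *\<^sub>R v\<^sub>0 - v = Q v *\<^sub>R p + P v *\<^sub>R q - Z v" for v
      by (subst (2) decomp[of v]) (simp add: v0 a_PQ algebra_simps)
    have refl'_PQZ: "(2 * c v) *\<^sub>R u - v = (Q v * \<alpha> / \<beta>) *\<^sub>R p + (P v * \<beta> / \<alpha>) *\<^sub>R q - Z v" for v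
    proof -
      have "2 * c v * \<alpha> - P v = Q v * \<alpha> / \<beta>" "2 * c v * \<beta> - Q v = P v * \<beta> / \<alpha>"
        using \<alpha>\<beta>(1,2) by (simp_all add: c_PQ distrib_left distrib_right)
      then have "(Q v * \<alpha> / \<beta>) *\<^sub>R p + (P v * \<beta> / \<alpha>) *\<^sub>R q - Z v
         = (2 * c v) *\<^sub>R u - (P v *\<^sub>R p + Q v *\<^sub>R q + Z v)"
        by (simp add: u algebra_simps flip: \<open>_ = Q v * \<alpha> / \<beta>\<close> \<open>_ = P v * \<beta> / \<alpha>\<close>)
      then show ?thesis using decomp[of v] by simp
    qed
    have refl_comp: "P (x *\<^sub>R p + y *\<^sub>R q - Z v) = x" "Q (x *\<^sub>R p + y *\<^sub>R q - Z v) = y"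
      "Z (x *\<^sub>R p + y *\<^sub>R q - Z v) = - Z v" for x y v
      by (simp_all add: P_lin Q_lin Z_lin PQ_basis Z_basis PQZ)
    define \<mu> where "\<mu> = \<alpha> / \<beta>"
    have \<mu>: "\<mu> > 1" using \<alpha>\<beta> by (simp add: \<mu>_def)
    have B_\<mu>: "B \<mu> v \<in> cone 1" if "v \<in> cone 1" for v
    proof -
      have "(2 * c ((2 * a v) *\<^sub>R v\<^sub>0 - v)) *\<^sub>R u - ((2 * a v) *\<^sub>R v\<^sub>0 - v) = B \<mu> v"
        unfolding refl'_PQZ refl_PQZ refl_comp by (simp add: B_def \<mu>_def ac_simps)
      then show ?thesis using refl[OF reflection_in_cone[OF that]] by simp
    qed
    \<comment> \<open>Conjugation with the reflection in \<open>v\<^sub>0\<close> inverts a boost.\<close>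
    have B_inverse: "B (1 / s) v \<in> cone 1" if "\<And>v. v \<in> cone 1 \<Longrightarrow> B s v \<in> cone 1" "v \<in> cone 1" for s v
    proof -
      define v' where "v' = (2 * a v) *\<^sub>R v\<^sub>0 - v"
      have "v' \<in> cone 1" unfolding v'_def by (rule reflection_in_cone[OF that(2)])
      then have "(2 * a (B s v')) *\<^sub>R v\<^sub>0 - B s v' \<in> cone 1" by (intro reflection_in_cone that(1))
      also have "(2 * a (B s v')) *\<^sub>R v\<^sub>0 - B s v' = B (1 / s) v"
        unfolding refl_PQZ B_PQZ unfolding v'_def refl_PQZ refl_comp by (simp add: B_def)
      finally show ?thesis .
    qed
    have B_pow: "B (\<mu> ^ k) v \<in> cone 1" if "v \<in> cone 1" for v k
      by (induction k) (simp_all add: B_1 that B_\<mu> flip: B_comp)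
    have b_PQZ: "b j v = (P v - Q v) *\<^sub>R b j w + b j (Z v)" if "j \<in> J" for j v
      using that by (subst decomp[of v]) (simp add: b_simps bp bq algebra_simps)
    \<comment> \<open>Under the powers of the boost, \<open>Q\<close> tends to 0 while the constraint keeps \<open>2 Q\<close> above the real part of
      the normalised value \<open>b j (Z v)\<close>. So this real part, a linear functional that does not change when a multiple of \<open>v\<^sub>0\<close> is added, is
      nowhere positive and thus 0.\<close>
    have extremal_Re: "Re (cnj (b j w) * b j (Z v)) = 0" if j: "j \<in> J" "cmod (b j w) = 1" for j v
    proof -
      let ?R = "\<lambda>v. Re (cnj (b j w) * b j (Z v))"
      have le_cone: "?R v \<le> 0" if v: "v \<in> cone 1" for v
      proof (rule ccontr)
        assume "\<not> ?R v \<le> 0"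
        then have pos: "?R v > 0" by simp
        obtain k where k: "2 * Q v / ?R v < \<mu> ^ k" using real_arch_pow[OF \<mu>] by blast
        have norm: "cnj (b j w) * b j w = 1" using j(2) complex_norm_square[of "b j w"] by (simp add: mult.commute)
        let ?y = "B (\<mu> ^ k) v"
        have "cnj (b j w) * b j ?y = of_real (P ?y - Q ?y) + cnj (b j w) * b j (Z ?y)"
          unfolding b_PQZ[OF j(1), of ?y] by (simp add: scaleR_conv_of_real distrib_left norm mult.left_commute)
        then have "P ?y - Q ?y + ?R v = Re (cnj (b j w) * b j ?y)"
          by (simp add: B_PQZ)
        also have "\<dots> \<le> cmod (b j ?y)"
          using complex_Re_le_cmod[of "cnj (b j w) * b j ?y"] j(2) by (simp add: norm_mult)
        also have "\<dots> \<le> P ?y + Q ?y" using B_pow[OF v, of k] j(1) by (auto simp: cone1_iff a_PQ)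
        finally have "?R v \<le> 2 * Q v / \<mu> ^ k" by (simp add: B_PQZ)
        then have "?R v * \<mu> ^ k \<le> 2 * Q v" using \<mu> by (simp add: field_simps)
        moreover have "2 * Q v < ?R v * \<mu> ^ k" using k pos by (simp add: field_simps)
        ultimately show False by simp
      qed
      have le: "?R v \<le> 0" for v
      proof -
        obtain M where "v + M *\<^sub>R v\<^sub>0 \<in> cone 1" using centre_absorbs by blast
        from le_cone[OF this] show ?thesis by (simp add: Z_lin v0 Z_basis)
      qed
      have "Z (- v) = - Z v" using Z_lin(3)[of "-1" v] by simp
      then show ?thesis using le[of v] le[of "- v"] j(1) by (simp add: b_simps)
    qed
    have extremal_iff: "cmod (b j v) \<le> a v \<longleftrightarrow>
        0 \<le> P v \<and> 0 \<le> Q v \<and> (Im (cnj (b j w) * b j (Z v)))\<^sup>2 \<le> 4 * (P v * Q v)"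
      if j: "j \<in> J" "cmod (b j w) = 1" for j v
    proof -
      let ?I = "Im (cnj (b j w) * b j (Z v))"
      have norm: "cnj (b j w) * b j w = 1" using j(2) complex_norm_square[of "b j w"] by (simp add: mult.commute)
      have "cnj (b j w) * b j v = of_real (P v - Q v) + cnj (b j w) * b j (Z v)"
        unfolding b_PQZ[OF j(1), of v] by (simp add: scaleR_conv_of_real distrib_left norm mult.left_commute)
      also have "\<dots> = Complex (P v - Q v) ?I"
        using extremal_Re[OF j, of v] by (simp add: complex_eq_iff)
      finally have "(cmod (cnj (b j w) * b j v))\<^sup>2 = (P v - Q v)\<^sup>2 + ?I\<^sup>2"
        by (simp add: cmod_power2)
      then have *: "(cmod (b j v))\<^sup>2 = (P v - Q v)\<^sup>2 + ?I\<^sup>2" by (simp add: norm_mult j(2))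
      have "cmod (b j v) \<le> a v \<longleftrightarrow> 0 \<le> a v \<and> (cmod (b j v))\<^sup>2 \<le> (a v)\<^sup>2"
        using norm_ge_zero[of "b j v"] by (smt (verit) power2_le_imp_le power_mono)
      also have "\<dots> \<longleftrightarrow> 0 \<le> P v + Q v \<and> ?I\<^sup>2 \<le> 4 * (P v * Q v)"
        unfolding * a_PQ by (simp add: power2_eq_square algebra_simps)
      also have "\<dots> \<longleftrightarrow> 0 \<le> P v \<and> 0 \<le> Q v \<and> ?I\<^sup>2 \<le> 4 * (P v * Q v)"
      proof -
        have "0 \<le> P v \<and> 0 \<le> Q v" if "0 \<le> P v + Q v" "?I\<^sup>2 \<le> 4 * (P v * Q v)"
        proof -
          have "0 \<le> P v * Q v" using that(2) zero_le_power2[of ?I] by linarith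
          then show ?thesis using that(1) by (auto simp: zero_le_mult_iff)
        qed
        then show ?thesis by auto
      qed
      finally show ?thesis .
    qed
    have PQ_nonneg: "0 \<le> P v" "0 \<le> Q v" if "v \<in> cone 1" for v
      using extremal_iff[OF j0(1) bw0, of v] that j0(1) by (auto simp: cone1_iff)
    have B_extremal: "cmod (b j (B s v)) \<le> a (B s v)"
      if j: "j \<in> J" "cmod (b j w) = 1" and v: "cmod (b j v) \<le> a v" and s: "s > 0" for j s v
      using v s unfolding extremal_iff[OF j] B_PQZ by simp
    \<comment> \<open>If \<open>P v > 0\<close>, a high power of the boost by \<open>\<mu>\<close> brings \<open>B s v\<close> into the cone, because \<open>P\<close> then dominates
      all constraints with \<open>|b j w| < 1\<close>; its inverse preserves the cone.\<close>
    have B_pos: "B s v \<in> cone 1" if v: "v \<in> cone 1" and s: "s > 0" and Pv: "P v > 0" for s v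
    proof -
      define y where "y = B s v"
      have Py: "P y > 0" and Qy: "Q y \<ge> 0" using Pv s PQ_nonneg[OF v] by (auto simp: y_def B_PQZ)
      have ext: "cmod (b j y) \<le> a y" if "j \<in> J" "cmod (b j w) = 1" for j
        unfolding y_def using v that s by (intro B_extremal) (auto simp: cone1_iff)
      have "\<forall>\<^sub>F k in sequentially. \<forall>j\<in>J. cmod (b j (B (\<mu> ^ k) y)) \<le> a (B (\<mu> ^ k) y)"
      proof (intro eventually_ball_finite fin ballI)
        fix j assume j: "j \<in> J"
        show "\<forall>\<^sub>F k in sequentially. cmod (b j (B (\<mu> ^ k) y)) \<le> a (B (\<mu> ^ k) y)"
        proof (cases "cmod (b j w) = 1")
          case True
          then show ?thesis using ext[OF j] \<mu> by (intro always_eventually allI B_extremal j) auto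
        next
          case False
          let ?m = "cmod (b j w)"
          have m: "?m < 1" using False bw[OF j] by simp
          have "\<forall>\<^sub>F k in sequentially. cmod (b j (Z y)) / ((1 - ?m) * P y) < \<mu> ^ k"
            by (rule eventually_power_gt[OF \<mu>])
          then show ?thesis
          proof (rule eventually_mono)
            fix k assume k: "cmod (b j (Z y)) / ((1 - ?m) * P y) < \<mu> ^ k"
            let ?x = "B (\<mu> ^ k) y"
            have pos: "0 \<le> P ?x" "0 \<le> Q ?x" using Py Qy \<mu> by (simp_all add: B_PQZ)
            have "cmod (b j ?x) \<le> \<bar>P ?x - Q ?x\<bar> * ?m + cmod (b j (Z y))"
              unfolding b_PQZ[OF j, of ?x] using norm_triangle_ineq[of "(P ?x - Q ?x) *\<^sub>R b j w" "b j (Z ?x)"]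
              by (simp add: B_PQZ)
            also have "\<dots> \<le> (P ?x + Q ?x) * ?m + cmod (b j (Z y))"
              using pos by (intro add_right_mono mult_right_mono) auto
            also have "cmod (b j (Z y)) \<le> (1 - ?m) * P ?x"
              using k Py m by (simp add: B_PQZ field_simps)
            also have "(P ?x + Q ?x) * ?m + (1 - ?m) * P ?x \<le> P ?x + Q ?x"
              using pos m mult_left_mono[of ?m 1 "Q ?x"] by (simp add: algebra_simps)
            finally show "cmod (b j ?x) \<le> a ?x" by (simp add: a_PQ)
          qed
        qed
      qed
      then obtain k where k: "B (\<mu> ^ k) y \<in> cone 1"
        by (auto simp: cone1_iff eventually_sequentially)
      have "B (1 / \<mu> ^ k) (B (\<mu> ^ k) y) \<in> cone 1" by (rule B_inverse[OF B_pow k])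
      then show ?thesis using \<mu> by (simp add: B_comp B_1 y_def)
    qed
    \<comment> \<open>The cone is closed, so the case \<open>P v = 0\<close> follows by adding a small multiple of \<open>v\<^sub>0\<close>.\<close>
    have B_cone: "B s v \<in> cone 1" if v: "v \<in> cone 1" and s: "s > 0" for s v
      unfolding cone1_iff
    proof (rule ballI, rule field_le_epsilon)
      fix j and e :: real assume j: "j \<in> J" and e: "e > 0"
      define D where "D = cmod (b j (B s v\<^sub>0)) + \<bar>a (B s v\<^sub>0)\<bar> + 1"
      have D: "D > 0" by (simp add: D_def add_nonneg_pos)
      define d where "d = e / D"
      have d: "d > 0" using e D by (simp add: d_def)
      have "P (v + d *\<^sub>R v\<^sub>0) > 0"
        using PQ_nonneg[OF v] d by (simp add: P_lin v0 PQ_basis add_nonneg_pos)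
      then have "B s (v + d *\<^sub>R v\<^sub>0) \<in> cone 1"
        using d by (intro B_pos s cone_add v cone_scale centre_in_cone) auto
      then have "cmod (b j (B s v) + d *\<^sub>R b j (B s v\<^sub>0)) \<le> a (B s v) + d * a (B s v\<^sub>0)"
        using j by (simp add: cone1_iff linear_add[OF B_lin] linear_cmul[OF B_lin] a_simps b_simps)
      then have "cmod (b j (B s v)) \<le> a (B s v) + d * a (B s v\<^sub>0) + d * cmod (b j (B s v\<^sub>0))"
        using norm_triangle_ineq4[of "b j (B s v) + d *\<^sub>R b j (B s v\<^sub>0)" "d *\<^sub>R b j (B s v\<^sub>0)"] d by simp
      also have "\<dots> \<le> a (B s v) + d * D"
      proof -
        have "a (B s v\<^sub>0) + cmod (b j (B s v\<^sub>0)) \<le> D" by (simp add: D_def)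
        from mult_left_mono[OF this, of d] show ?thesis using d unfolding distrib_left by linarith
      qed
      also have "d * D = e" using D by (simp add: d_def)
      finally show "cmod (b j (B s v)) \<le> a (B s v) + e" .
    qed
    define s where "s = sqrt \<mu>"
    have s: "s > 0" "s\<^sup>2 = \<mu>" using \<mu> by (simp_all add: s_def)
    have inv: "B s (B (1 / s) v) = v" "B (1 / s) (B s v) = v" for v
      using s by (simp_all add: B_comp B_1)
    \<comment> \<open>The two expressions for \<open>\<kappa>\<close> agree because \<open>s\<^sup>2 = \<alpha> / \<beta>\<close>; they match the coefficients at \<open>p\<close> and \<open>q\<close>.\<close>
    define \<kappa> where "\<kappa> = s / (2 * \<alpha>)"
    have \<kappa>: "\<kappa> = 1 / (s * (2 * \<beta>))"
      using s \<alpha>\<beta> by (simp add: \<kappa>_def \<mu>_def power2_eq_square field_simps)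
    show thesis
    proof (rule that[of "B s" \<kappa>])
      show "linear (B s)" by (rule B_lin)
      show "bij (B s)" using inv by (intro o_bij[of "B (1 / s)"]) (auto simp: fun_eq_iff)
      show "B s ` cone 1 = cone 1"
      proof
        show "cone 1 \<subseteq> B s ` cone 1"
        proof
          fix v assume "v \<in> cone 1"
          then have "B (1 / s) v \<in> cone 1" using s by (intro B_cone) auto
          then show "v \<in> B s ` cone 1" using inv(1)[of v] by (metis image_eqI)
        qed
      qed (use s in \<open>auto intro: B_cone\<close>)
      show "\<kappa> \<noteq> 0" using s \<alpha>\<beta> by (simp add: \<kappa>_def)
      have \<kappa>\<alpha>: "\<kappa> * \<alpha> = s / 2" using \<alpha>\<beta> by (simp add: \<kappa>_def)
      have \<kappa>\<beta>: "\<kappa> * \<beta> = 1 / (2 * s)" using \<alpha>\<beta> s by (simp add: \<kappa>)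
      have "B s v\<^sub>0 = (s / 2) *\<^sub>R p + (1 / (2 * s)) *\<^sub>R q"
        by (simp add: B_def v0 P_lin Q_lin Z_lin PQ_basis Z_basis)
      then show "B s v\<^sub>0 = \<kappa> *\<^sub>R u" unfolding u by (simp add: scaleR_add_right \<kappa>\<alpha> \<kappa>\<beta>)
      show "c (B s v) = \<kappa> * a v" for v
      proof -
        have "c (B s v) = s / (2 * \<alpha>) * P v + 1 / (s * (2 * \<beta>)) * Q v"
          by (simp add: c_PQ B_PQZ)
        also have "\<dots> = \<kappa> * P v + \<kappa> * Q v" by (simp only: \<kappa>_def[symmetric] \<kappa>[symmetric])
        finally show ?thesis by (simp add: a_PQ distrib_left)
      qed
    qed
  qed
qed

end

text \<open>Pull the centre of the second cone back along \<open>L\<close> and exchange it with the centre of the first one; the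
corrected map transports the pair of functional and centre up to a common scalar, hence all cones.\<close>

theorem norm_cones_equivalent:
  fixes a :: "'v::real_vector \<Rightarrow> real" and a' :: "'w::real_vector \<Rightarrow> real"
  assumes "norm_cone a b J v\<^sub>0" and "norm_cone a' b' J' v\<^sub>0'"
    and linL: "linear L" and bijL: "bij L"
    and L: "L ` norm_cone.cone a b J 1 = norm_cone.cone a' b' J' 1"
  obtains L' where "linear L'" "bij L'"
    "\<And>\<rho>. L' ` norm_cone.cone a b J \<rho> = norm_cone.cone a' b' J' \<rho>"
proof -
  interpret N: norm_cone a b J v\<^sub>0 by fact
  interpret N': norm_cone a' b' J' v\<^sub>0' by fact
  note L_simps = linear_add[OF linL] linear_diff[OF linL] linear_cmul[OF linL]
  have L_iff: "L v \<in> N'.cone 1 \<longleftrightarrow> v \<in> N.cone 1" for v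
    using L bij_is_inj[OF bijL] by (metis inj_image_mem_iff)
  define u where "u = inv L v\<^sub>0'"
  have Lu: "L u = v\<^sub>0'" using bijL by (simp add: u_def bij_is_surj surj_f_inv_f)
  have h1: "linear (a' \<circ> L)" by (rule linear_compose[OF linL N'.lin_a])
  have h2: "(a' \<circ> L) u = 1" by (simp add: Lu N'.a_centre)
  have h3: "u \<in> N.cone 1" using N'.centre_in_cone by (simp flip: L_iff add: Lu)
  have h4: "\<exists>M>0. v + M *\<^sub>R u \<in> N.cone 1" for v
      using N'.centre_absorbs[of "L v"] by (simp flip: L_iff add: L_simps Lu)
  have h5: "(2 * (a' \<circ> L) v) *\<^sub>R u - v \<in> N.cone 1" if "v \<in> N.cone 1" for v
      using N'.reflection_in_cone[of "L v"] that by (simp add: L_iff[symmetric] L_simps Lu)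
  obtain g \<kappa> where g: "linear g" "bij g" "g ` N.cone 1 = N.cone 1" "\<kappa> \<noteq> 0"
    "g v\<^sub>0 = \<kappa> *\<^sub>R u" "\<And>v. (a' \<circ> L) (g v) = \<kappa> * a v"
    using N.centre_exchange[OF h1 h2 h3 h4 h5] by blast
  have g_iff: "g v \<in> N.cone 1 \<longleftrightarrow> v \<in> N.cone 1" for v
    using g(3) bij_is_inj[OF g(2)] by (metis inj_image_mem_iff)
  have lin: "linear (L \<circ> g)" and bij: "bij (L \<circ> g)"
    using linear_compose[OF g(1) linL] bij_comp[OF g(2) bijL] by auto
  have iff: "(L \<circ> g) v \<in> N'.cone \<rho> \<longleftrightarrow> v \<in> N.cone \<rho>" for v \<rho>
  proof -
    have "(L \<circ> g) v \<in> N'.cone \<rho> \<longleftrightarrow> L (g v) - ((1 - \<rho>) * (\<kappa> * a v)) *\<^sub>R v\<^sub>0' \<in> N'.cone 1"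
      using g(6)[of v] by (simp add: N'.cone_eq_shift[of _ \<rho>])
    also have "L (g v) - ((1 - \<rho>) * (\<kappa> * a v)) *\<^sub>R v\<^sub>0' = L (g (v - ((1 - \<rho>) * a v) *\<^sub>R v\<^sub>0))"
      by (simp add: linear_diff[OF g(1)] linear_cmul[OF g(1)] g(5) L_simps Lu ac_simps)
    also have "\<dots> \<in> N'.cone 1 \<longleftrightarrow> v \<in> N.cone \<rho>"
      by (simp add: L_iff g_iff N.cone_eq_shift[of _ \<rho>])
    finally show ?thesis .
  qed
  show thesis
  proof (rule that[OF lin bij])
    fix \<rho>
    show "(L \<circ> g) ` N.cone \<rho> = N'.cone \<rho>"
    proof
      show "N'.cone \<rho> \<subseteq> (L \<circ> g) ` N.cone \<rho>"
      proof
        fix w assume w: "w \<in> N'.cone \<rho>"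
        obtain v where "w = (L \<circ> g) v" using bij_is_surj[OF bij] by (metis surjD)
        then show "w \<in> (L \<circ> g) ` N.cone \<rho>" using w iff by auto
      qed
    qed (use iff in blast)
  qed
qed

section \<open>Lifting differentiability through a map close to the identity\<close>

lemma onorm_le_sum_Basis:
  fixes f :: "'v::euclidean_space \<Rightarrow> 'w::real_normed_vector"
  assumes "linear f"
  shows "onorm f \<le> (\<Sum>i\<in>Basis. norm (f i))"
proof (rule onorm_le)
  fix x
  have "f x = (\<Sum>i\<in>Basis. (x \<bullet> i) *\<^sub>R f i)"
    using linear_sum[OF assms, of "\<lambda>i. (x \<bullet> i) *\<^sub>R i" Basis]
    by (simp add: linear_cmul[OF assms] euclidean_representation)
  also have "norm \<dots> \<le> (\<Sum>i\<in>Basis. norm x * norm (f i))"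
    by (intro sum_norm_le) (simp add: Basis_le_norm mult_right_mono)
  finally show "norm (f x) \<le> (\<Sum>i\<in>Basis. norm (f i)) * norm x"
    by (simp add: sum_distrib_left mult.commute)
qed

text \<open>By continuity of the derivative \<open>G - id\<close> is a contraction with constant 1/2 near \<open>z\<^sub>0\<close>.\<close>

lemma C1_near_identity_expansive:
  fixes G :: "'v::euclidean_space \<Rightarrow> 'v"
  assumes U: "open U" "z\<^sub>0 \<in> U"
    and G: "\<And>z. z \<in> U \<Longrightarrow> (G has_derivative G' z) (at z)"
    and cont: "\<And>v. continuous_on U (\<lambda>z. G' z v)"
    and G0: "G' z\<^sub>0 = id"
  obtains \<delta> where "\<delta> > 0" "ball z\<^sub>0 \<delta> \<subseteq> U"
    "\<And>x y. x \<in> ball z\<^sub>0 \<delta> \<Longrightarrow> y \<in> ball z\<^sub>0 \<delta> \<Longrightarrow> norm (x - y) \<le> 2 * norm (G x - G y)"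
proof -
  \<comment> \<open>With this bound on each basis vector the operator norm of the derivative of \<open>G - id\<close> is at most 1/2.\<close>
  define e where "e = (1::real) / (2 * DIM('v))"
  have e: "e > 0" by (simp add: e_def)
  have "\<forall>\<^sub>F z in nhds z\<^sub>0. \<forall>i\<in>Basis. norm (G' z i - i) < e"
  proof (intro eventually_ball_finite ballI)
    fix i :: 'v assume "i \<in> Basis"
    have "isCont (\<lambda>z. G' z i) z\<^sub>0"
      using cont[of i] U by (simp add: continuous_on_eq_continuous_at)
    then have "((\<lambda>z. G' z i) \<longlongrightarrow> i) (nhds z\<^sub>0)"
      using G0 by (simp add: isCont_def tendsto_nhds_iff)
    then show "\<forall>\<^sub>F z in nhds z\<^sub>0. norm (G' z i - i) < e"
      using e by (auto simp: tendsto_iff dist_norm)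
  qed auto
  moreover have "\<forall>\<^sub>F z in nhds z\<^sub>0. z \<in> U" using U by (auto simp: eventually_nhds)
  ultimately have "\<forall>\<^sub>F z in nhds z\<^sub>0. z \<in> U \<and> (\<forall>i\<in>Basis. norm (G' z i - i) < e)"
    by (rule eventually_conj[rotated])
  then obtain \<delta> where \<delta>: "\<delta> > 0"
    "\<And>z. dist z z\<^sub>0 < \<delta> \<Longrightarrow> z \<in> U \<and> (\<forall>i\<in>Basis. norm (G' z i - i) < e)"
    unfolding eventually_nhds_metric by blast
  show thesis
  proof (rule that[OF \<delta>(1)])
    show sub: "ball z\<^sub>0 \<delta> \<subseteq> U" using \<delta>(2) by (auto simp: dist_commute)
    fix x y assume xy: "x \<in> ball z\<^sub>0 \<delta>" "y \<in> ball z\<^sub>0 \<delta>"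
    have "norm ((G x - x) - (G y - y)) \<le> 1/2 * norm (x - y)"
    proof (rule differentiable_bound[OF convex_ball _ _ xy])
      fix z assume z: "z \<in> ball z\<^sub>0 \<delta>"
      then have zU: "z \<in> U" using sub by auto
      show "((\<lambda>z. G z - z) has_derivative (\<lambda>v. G' z v - v)) (at z within ball z\<^sub>0 \<delta>)"
        by (intro has_derivative_diff has_derivative_ident has_derivative_at_withinI[OF G[OF zU]])
      have "linear (\<lambda>v. G' z v - v)"
        using linear_compose_sub[OF has_derivative_linear[OF G[OF zU]] linear_ident] .
      then have "onorm (\<lambda>v. G' z v - v) \<le> (\<Sum>i\<in>Basis. norm (G' z i - i))"
        by (rule onorm_le_sum_Basis)
      also have "\<dots> \<le> (\<Sum>i\<in>(Basis::'v set). e)"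
        using \<delta>(2)[of z] z by (intro sum_mono) (auto simp: dist_commute intro: less_imp_le)
      also have "\<dots> = 1/2" by (simp add: e_def)
      finally show "onorm (\<lambda>v. G' z v - v) \<le> 1/2" .
    qed
    moreover have "norm (x - y) \<le> norm (G x - G y) + norm ((G x - x) - (G y - y))"
      using norm_triangle_ineq4[of "G x - G y" "(G x - x) - (G y - y)"] by (simp add: algebra_simps)
    ultimately show "norm (x - y) \<le> 2 * norm (G x - G y)" by simp
  qed
qed

text \<open>The expansion of \<open>G\<close> at \<open>h z\<^sub>0\<close> gives \<open>h z - h z\<^sub>0 = H z - H z\<^sub>0 + o(h z - h z\<^sub>0)\<close>. With error constant 1/2 it
shows that \<open>h\<close> is Lipschitz at \<open>z\<^sub>0\<close>, and this turns the error term into \<open>o(z - z\<^sub>0)\<close>.\<close>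

lemma has_derivative_of_lift:
  fixes h :: "'u::real_normed_vector \<Rightarrow> 'v::real_normed_vector"
  assumes G: "(G has_derivative id) (at (h z\<^sub>0))"
    and H: "(H has_derivative H') (at z\<^sub>0)"
    and eq: "\<forall>\<^sub>F z in nhds z\<^sub>0. G (h z) = H z"
    and cont: "(h \<longlongrightarrow> h z\<^sub>0) (nhds z\<^sub>0)"
  shows "(h has_derivative H') (at z\<^sub>0)"
proof -
  have bl: "bounded_linear H'" by (rule has_derivative_bounded_linear[OF H])
  obtain B where B: "B > 0" "\<And>v. norm (H' v) \<le> norm v * B"
    using bounded_linear.pos_bounded[OF bl] by blast
  have eq0: "G (h z\<^sub>0) = H z\<^sub>0" using eventually_nhds_x_imp_x[OF eq] .
  have G_alt: "\<forall>\<^sub>F y in nhds (h z\<^sub>0). norm (G y - G (h z\<^sub>0) - (y - h z\<^sub>0)) \<le> e * norm (y - h z\<^sub>0)"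
    if "e > 0" for e
    using G that by (auto simp: has_derivative_at_alt eventually_nhds_metric dist_norm)
  have H_alt: "\<forall>\<^sub>F z in nhds z\<^sub>0. norm (H z - H z\<^sub>0 - H' (z - z\<^sub>0)) \<le> e * norm (z - z\<^sub>0)"
    if "e > 0" for e
    using H that by (auto simp: has_derivative_at_alt eventually_nhds_metric dist_norm)
  have Gh: "\<forall>\<^sub>F z in nhds z\<^sub>0. norm (H z - H z\<^sub>0 - (h z - h z\<^sub>0)) \<le> e * norm (h z - h z\<^sub>0)"
    if "e > 0" for e
    using eq filterlim_iff[THEN iffD1, OF cont, rule_format, OF G_alt[OF that]]
    by eventually_elim (simp add: eq0)
  have lip: "\<forall>\<^sub>F z in nhds z\<^sub>0. norm (h z - h z\<^sub>0) \<le> 2 * (1 + B) * norm (z - z\<^sub>0)"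
    using Gh[of "1/2", OF half_gt_zero[OF zero_less_one]] H_alt[of 1, OF zero_less_one]
  proof eventually_elim
    case (elim z)
    have "norm (h z - h z\<^sub>0) \<le> norm (H z - H z\<^sub>0) + norm (H z - H z\<^sub>0 - (h z - h z\<^sub>0))"
      using norm_triangle_ineq4[of "H z - H z\<^sub>0" "H z - H z\<^sub>0 - (h z - h z\<^sub>0)"] by simp
    moreover have "norm (H z - H z\<^sub>0) \<le> norm (H z - H z\<^sub>0 - H' (z - z\<^sub>0)) + norm (H' (z - z\<^sub>0))"
      using norm_triangle_ineq[of "H z - H z\<^sub>0 - H' (z - z\<^sub>0)" "H' (z - z\<^sub>0)"] by simp
    ultimately show ?case using elim B(2)[of "z - z\<^sub>0"] by (simp add: algebra_simps)
  qed
  have "\<forall>\<^sub>F z in nhds z\<^sub>0. norm (h z - h z\<^sub>0 - H' (z - z\<^sub>0)) \<le> e * norm (z - z\<^sub>0)" if e: "e > 0" for e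
  proof -
    define d where "d = e / (4 * (1 + B))"
    have d: "d > 0" using e B by (simp add: d_def)
    show ?thesis
      using lip Gh[OF d] H_alt[of "e / 2", OF half_gt_zero[OF e]]
    proof eventually_elim
      case (elim z)
      have "norm (h z - h z\<^sub>0 - H' (z - z\<^sub>0))
          \<le> norm (H z - H z\<^sub>0 - H' (z - z\<^sub>0)) + norm (H z - H z\<^sub>0 - (h z - h z\<^sub>0))"
      proof -
        have "h z - h z\<^sub>0 - H' (z - z\<^sub>0) = (H z - H z\<^sub>0 - H' (z - z\<^sub>0)) - (H z - H z\<^sub>0 - (h z - h z\<^sub>0))"
          by simp
        then show ?thesis by (metis norm_triangle_ineq4)
      qed
      also have "norm (H z - H z\<^sub>0 - (h z - h z\<^sub>0)) \<le> d * (2 * (1 + B) * norm (z - z\<^sub>0))"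
        using elim(1,2) d by (meson mult_left_mono less_imp_le order_trans)
      also have "d * (2 * (1 + B) * norm (z - z\<^sub>0)) = e / 2 * norm (z - z\<^sub>0)"
        using B by (simp add: d_def field_simps)
      finally show ?case using elim(3) e by simp
    qed
  qed
  then show ?thesis
    unfolding has_derivative_at_alt using bl by (auto simp: eventually_nhds_metric dist_norm)
qed

section \<open>Tangent vectors in charts\<close>

locale smooth_mfd =
  fixes A :: "('a::{t2_space, second_countable_topology}, 'n::finite) chart set"
  assumes smooth_manifold: "smooth_manifold A"
begin

lemma chart_homeo:
  assumes "c \<in> A"
  shows "open (fst c)" "open (snd c ` fst c)"
    "homeomorphism (fst c) (snd c ` fst c) (snd c) (chart_inv c)"
  using smooth_manifold assms by (auto simp: smooth_manifold_def)

lemma chart_inv_chart: "c \<in> A \<Longrightarrow> x \<in> fst c \<Longrightarrow> chart_inv c (snd c x) = x"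
  using chart_homeo(3) by (auto simp: homeomorphism_def)

lemma chart_chart_inv:
  assumes "c \<in> A" "z \<in> snd c ` fst c"
  shows "snd c (chart_inv c z) = z" "chart_inv c z \<in> fst c"
  using chart_homeo(3)[OF assms(1)] assms(2) by (auto simp: homeomorphism_def)

lemma charts_atD: "c \<in> charts_at A x \<Longrightarrow> c \<in> A" "c \<in> charts_at A x \<Longrightarrow> x \<in> fst c"
  by (simp_all add: charts_at_def)

lemma some_chart: "some_chart A x \<in> charts_at A x"
proof -
  have "x \<in> (\<Union>c\<in>A. fst c)" using smooth_manifold by (simp add: smooth_manifold_def)
  then have "\<exists>c. c \<in> charts_at A x" by (auto simp: charts_at_def)
  then show ?thesis unfolding some_chart_def by (rule someI_ex)
qed

lemma eventually_chart_inv: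
  assumes c: "c \<in> charts_at A x" and V: "\<forall>\<^sub>F y in nhds x. Q y"
  shows "\<forall>\<^sub>F z in nhds (snd c x). z \<in> snd c ` fst c \<and> Q (chart_inv c z)"
proof -
  note h = chart_homeo[OF charts_atD(1)[OF c]]
  have "snd c x \<in> snd c ` fst c" using charts_atD(2)[OF c] by blast
  moreover have "isCont (chart_inv c) (snd c x)"
    using h(2,3) calculation by (auto simp: homeomorphism_def continuous_on_eq_continuous_at)
  then have "(chart_inv c \<longlongrightarrow> x) (nhds (snd c x))"
    by (simp add: isCont_def tendsto_nhds_iff chart_inv_chart[OF charts_atD[OF c]])
  then have "\<forall>\<^sub>F z in nhds (snd c x). Q (chart_inv c z)"
    using V by (auto simp: filterlim_iff)
  moreover have "\<forall>\<^sub>F z in nhds (snd c x). z \<in> snd c ` fst c"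
    using h(2) calculation(1) by (rule eventually_nhds_in_open)
  ultimately show ?thesis by (auto intro: eventually_conj)
qed

lemma open_chart_preimage:
  assumes "c \<in> A" "open V"
  shows "open {y \<in> fst c. snd c y \<in> V}"
proof -
  have "continuous_on (fst c) (snd c)" using chart_homeo(3)[OF assms(1)] by (simp add: homeomorphism_def)
  from continuous_open_preimage[OF this chart_homeo(1)[OF assms(1)] assms(2)]
  show ?thesis by (simp add: Int_def vimage_def)
qed

lemma has_derivative_transition:
  assumes c: "c \<in> charts_at A x" and d: "d \<in> charts_at A x"
  shows "(snd d \<circ> chart_inv c has_derivative transition_deriv c d x) (at (snd c x))"
proof -
  have "smooth_on (snd d \<circ> chart_inv c) (snd c ` (fst c \<inter> fst d))"
    using smooth_manifold charts_atD(1)[OF c] charts_atD(1)[OF d] by (auto simp: smooth_manifold_def)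
  then have "Ck_on (Suc 0) (snd d \<circ> chart_inv c) (snd c ` (fst c \<inter> fst d))"
    unfolding smooth_on_def by blast
  moreover have "snd c x \<in> snd c ` (fst c \<inter> fst d)"
    using charts_atD(2)[OF c] charts_atD(2)[OF d] by blast
  ultimately have "(snd d \<circ> chart_inv c) differentiable (at (snd c x))" by auto
  then show ?thesis unfolding transition_deriv_def by (simp add: frechet_derivative_works)
qed

lemma linear_transition:
  "c \<in> charts_at A x \<Longrightarrow> d \<in> charts_at A x \<Longrightarrow> linear (transition_deriv c d x)"
  using has_derivative_transition has_derivative_linear by blast

lemma has_derivative_change_chart:
  assumes c: "c \<in> charts_at A x" and d: "d \<in> charts_at A x"
    and g: "(g \<circ> chart_inv d has_derivative D) (at (snd d x))"
  shows "(g \<circ> chart_inv c has_derivative D \<circ> transition_deriv c d x) (at (snd c x))"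
proof -
  have cx: "(snd d \<circ> chart_inv c) (snd c x) = snd d x"
    by (simp add: chart_inv_chart[OF charts_atD[OF c]])
  have "((g \<circ> chart_inv d) \<circ> (snd d \<circ> chart_inv c) has_derivative D \<circ> transition_deriv c d x) (at (snd c x))"
    by (rule diff_chain_at[OF has_derivative_transition[OF c d]]) (simp only: cx g)
  moreover have "\<forall>\<^sub>F y in nhds x. y \<in> fst d"
    using chart_homeo(1)[OF charts_atD(1)[OF d]] charts_atD(2)[OF d] by (rule eventually_nhds_in_open)
  from eventually_chart_inv[OF c this]
  have "\<forall>\<^sub>F z in nhds (snd c x). ((g \<circ> chart_inv d) \<circ> (snd d \<circ> chart_inv c)) z = (g \<circ> chart_inv c) z"
    by eventually_elim (simp add: chart_inv_chart[OF charts_atD(1)[OF d]])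
  then obtain S where "open S" "snd c x \<in> S"
    "\<And>z. z \<in> S \<Longrightarrow> ((g \<circ> chart_inv d) \<circ> (snd d \<circ> chart_inv c)) z = (g \<circ> chart_inv c) z"
    unfolding eventually_nhds by blast
  ultimately show ?thesis by (rule has_derivative_transform_within_open) 
qed

text \<open>The chain rule for transitions; it makes the families defining \<open>tvec_of\<close> genuine tangent vectors.\<close>

lemma transition_cocycle:
  assumes "c \<in> charts_at A x" "d \<in> charts_at A x" "e \<in> charts_at A x"
  shows "transition_deriv d e x (transition_deriv c d x u) = transition_deriv c e x u"
  using has_derivative_unique[OF has_derivative_change_chart[OF assms(1,2) has_derivative_transition[OF assms(2,3)]]
      has_derivative_transition[OF assms(1,3)]]
  by (simp add: fun_eq_iff)

lemma transition_self:
  assumes c: "c \<in> charts_at A x"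
  shows "transition_deriv c c x u = u"
proof -
  have "\<forall>\<^sub>F z in nhds (snd c x). z = (snd c \<circ> chart_inv c) z"
    using eventually_chart_inv[OF c always_eventually, of "\<lambda>_. True"]
    by (auto elim!: eventually_mono simp: chart_chart_inv[OF charts_atD(1)[OF c]])
  then obtain S where S: "open S" "snd c x \<in> S" "\<And>z. z \<in> S \<Longrightarrow> z = (snd c \<circ> chart_inv c) z"
    unfolding eventually_nhds by blast
  have "(snd c \<circ> chart_inv c has_derivative (\<lambda>u. u)) (at (snd c x))"
    by (rule has_derivative_transform_within_open[OF has_derivative_ident S])
  from has_derivative_unique[OF has_derivative_transition[OF c c] this]
  show ?thesis by (simp add: fun_eq_iff)
qed

text \<open>The maps \<open>coord x\<close> and \<open>tangent x\<close> are mutually inverse linear isomorphisms between \<open>tangent_space A x\<close> and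
\<open>real^'n\<close>. Linear algebra is done on the latter, where functions need not be restricted to a carrier.\<close>

abbreviation coord :: "'a \<Rightarrow> ('a, 'n) tvec \<Rightarrow> real^'n"
  where "coord x v \<equiv> v (some_chart A x)"

abbreviation tangent :: "'a \<Rightarrow> real^'n \<Rightarrow> ('a, 'n) tvec"
  where "tangent x u \<equiv> tvec_of A (some_chart A x) x u"

lemma tangent_spaceI:
  assumes "\<And>c. c \<notin> charts_at A x \<Longrightarrow> v c = 0"
    and "\<And>c d. c \<in> charts_at A x \<Longrightarrow> d \<in> charts_at A x \<Longrightarrow> transition_deriv c d x (v c) = v d"
  shows "v \<in> tangent_space A x"
  using assms unfolding tangent_space_def by simp

lemma tangent_spaceD:
  assumes "v \<in> tangent_space A x"
  shows "\<And>c. c \<notin> charts_at A x \<Longrightarrow> v c = 0"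
    and "\<And>c d. c \<in> charts_at A x \<Longrightarrow> d \<in> charts_at A x \<Longrightarrow> transition_deriv c d x (v c) = v d"
proof -
  show "v c = 0" if "c \<notin> charts_at A x" for c
    using assms that unfolding tangent_space_def by blast
  have eq: "v d = transition_deriv c d x (v c)" if "c \<in> charts_at A x" "d \<in> charts_at A x" for c d
    using assms that unfolding tangent_space_def by blast
  show "transition_deriv c d x (v c) = v d" if "c \<in> charts_at A x" "d \<in> charts_at A x" for c d
    using eq[OF that] by (rule sym)
qed

lemma tangent_in: "tangent x u \<in> tangent_space A x"
  by (rule tangent_spaceI) (simp_all add: tvec_of_def transition_cocycle[OF some_chart])

lemma coord_tangent: "coord x (tangent x u) = u"
  by (simp add: tvec_of_def some_chart transition_self)

lemma tangent_coord:
  assumes "v \<in> tangent_space A x"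
  shows "tangent x (coord x v) = v"
proof
  fix d show "tangent x (coord x v) d = v d"
    by (simp add: tvec_of_def tangent_spaceD[OF assms] some_chart)
qed

lemma coord_inject: "v \<in> tangent_space A x \<Longrightarrow> w \<in> tangent_space A x \<Longrightarrow> coord x v = coord x w \<Longrightarrow> v = w"
  by (metis tangent_coord)

lemma tangent_space_lin:
  shows "0 \<in> tangent_space A x"
    and "v \<in> tangent_space A x \<Longrightarrow> w \<in> tangent_space A x \<Longrightarrow> v + w \<in> tangent_space A x"
    and "v \<in> tangent_space A x \<Longrightarrow> s *\<^sub>R v \<in> tangent_space A x"
proof -
  show "0 \<in> tangent_space A x"
    by (rule tangent_spaceI) (simp_all add: linear_0[OF linear_transition])
  show "v + w \<in> tangent_space A x" if v: "v \<in> tangent_space A x" and w: "w \<in> tangent_space A x"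
    by (rule tangent_spaceI)
      (simp_all add: tangent_spaceD[OF v] tangent_spaceD[OF w] linear_add[OF linear_transition])
  show "s *\<^sub>R v \<in> tangent_space A x" if v: "v \<in> tangent_space A x"
    by (rule tangent_spaceI)
      (simp_all add: scaleR_fun_def tangent_spaceD[OF v] linear_cmul[OF linear_transition])
qed

lemma coord_lin:
  "coord x 0 = 0" "coord x (v + w) = coord x v + coord x w" "coord x (s *\<^sub>R v) = s *\<^sub>R coord x v"
  by (simp_all add: scaleR_fun_def)

lemma tangent_lin:
  "tangent x (u + w) = tangent x u + tangent x w" "tangent x (s *\<^sub>R u) = s *\<^sub>R tangent x u"
  by (rule coord_inject[of _ x]; simp add: tangent_in tangent_space_lin coord_tangent coord_lin del: plus_fun_apply)+

end

context smooth_mfd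
begin

lemma tendsto_chart_inv:
  assumes c: "c \<in> charts_at A x"
  shows "(chart_inv c \<longlongrightarrow> x) (nhds (snd c x))"
  unfolding filterlim_iff
proof (intro allI impI)
  fix P assume "\<forall>\<^sub>F y in nhds x. P y"
  from eventually_chart_inv[OF c this] show "\<forall>\<^sub>F z in nhds (snd c x). P (chart_inv c z)"
    by eventually_elim simp
qed

lemma tendsto_chart:
  assumes c: "c \<in> charts_at A x"
  shows "(snd c \<longlongrightarrow> snd c x) (nhds x)"
proof -
  note h = chart_homeo[OF charts_atD(1)[OF c]]
  have "isCont (snd c) x"
    using h(1,3) charts_atD(2)[OF c] by (auto simp: homeomorphism_def continuous_on_eq_continuous_at)
  then show ?thesis by (simp add: isCont_def tendsto_nhds_iff)
qed

lemma eventually_in_chart: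
  assumes c: "c \<in> charts_at A x"
  shows "\<forall>\<^sub>F y in nhds x. y \<in> fst c"
  using chart_homeo(1)[OF charts_atD(1)[OF c]] charts_atD(2)[OF c] by (rule eventually_nhds_in_open)

lemma C1_in_chart:
  assumes g: "Ck_fun_on A 1 U g" and c: "c \<in> A"
  shows "z \<in> snd c ` (fst c \<inter> U) \<Longrightarrow>
      (g \<circ> chart_inv c has_derivative frechet_derivative (g \<circ> chart_inv c) (at z)) (at z)"
    and "continuous_on (snd c ` (fst c \<inter> U)) (\<lambda>z. frechet_derivative (g \<circ> chart_inv c) (at z) v)"
proof -
  have "Ck_on (Suc 0) (g \<circ> chart_inv c) (snd c ` (fst c \<inter> U))"
    using g c unfolding Ck_fun_on_def by simp
  then have "\<forall>z\<in>snd c ` (fst c \<inter> U). g \<circ> chart_inv c differentiable at z"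
    and "\<forall>v. continuous_on (snd c ` (fst c \<inter> U)) (\<lambda>z. frechet_derivative (g \<circ> chart_inv c) (at z) v)"
    unfolding Ck_on.simps by blast+
  then show "z \<in> snd c ` (fst c \<inter> U) \<Longrightarrow>
      (g \<circ> chart_inv c has_derivative frechet_derivative (g \<circ> chart_inv c) (at z)) (at z)"
    and "continuous_on (snd c ` (fst c \<inter> U)) (\<lambda>z. frechet_derivative (g \<circ> chart_inv c) (at z) v)"
    unfolding frechet_derivative_works by blast+
qed

abbreviation coord_deriv :: "('a \<Rightarrow> 'b::real_normed_vector) \<Rightarrow> 'a \<Rightarrow> real^'n \<Rightarrow> 'b"
  where "coord_deriv g x \<equiv> frechet_derivative (g \<circ> chart_inv (some_chart A x)) (at (snd (some_chart A x) x))"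

lemma differential_eq: "differential A g x v = coord_deriv g x (coord x v)"
  unfolding differential_def Let_def ..

lemma has_derivative_coord_deriv:
  assumes "Ck_fun_on A 1 U g" "x \<in> U"
  shows "(g \<circ> chart_inv (some_chart A x) has_derivative coord_deriv g x) (at (snd (some_chart A x) x))"
  using assms charts_atD[OF some_chart, of x] by (intro C1_in_chart(1)) auto

lemma linear_coord_deriv:
  assumes "Ck_fun_on A 1 U g" "x \<in> U"
  shows "linear (coord_deriv g x)"
  using has_derivative_coord_deriv[OF assms] by (rule has_derivative_linear)

lemma C1_tendsto:
  assumes "Ck_fun_on A 1 U g" "x \<in> U"
  shows "(g \<longlongrightarrow> g x) (nhds x)"
proof -
  let ?c = "some_chart A x"
  note inv = chart_inv_chart[OF charts_atD(1)[OF some_chart]]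
  have "isCont (g \<circ> chart_inv ?c) (snd ?c x)"
    using has_derivative_coord_deriv[OF assms] by (rule has_derivative_continuous)
  then have "((g \<circ> chart_inv ?c) \<longlongrightarrow> g x) (nhds (snd ?c x))"
    by (simp add: isCont_def tendsto_nhds_iff inv charts_atD(2)[OF some_chart])
  from filterlim_compose[OF this tendsto_chart[OF some_chart]]
  have "((\<lambda>y. g (chart_inv ?c (snd ?c y))) \<longlongrightarrow> g x) (nhds x)" by simp
  moreover have "\<forall>\<^sub>F y in nhds x. g (chart_inv ?c (snd ?c y)) = g y"
    using eventually_in_chart[OF some_chart] by eventually_elim (simp add: inv)
  ultimately show ?thesis by (rule Lim_transform_eventually)
qed

text \<open>Knowing the derivative of \<open>g\<close> in one chart of the target suffices for every other chart and for every
function on the target: this serves both for the well-definedness of \<open>tangent_map\<close> and for pulling back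
eigenfunctions.\<close>

lemma has_derivative_comp_chart:
  assumes c: "c \<in> charts_at A x" and d: "d \<in> charts_at A (g x)"
    and g: "(g \<longlongrightarrow> g x) (nhds x)"
    and G': "(snd d \<circ> g \<circ> chart_inv c has_derivative G') (at (snd c x))"
    and K': "(k \<circ> chart_inv d has_derivative K') (at (snd d (g x)))"
  shows "(k \<circ> g \<circ> chart_inv c has_derivative K' \<circ> G') (at (snd c x))"
proof -
  have "(snd d \<circ> g \<circ> chart_inv c) (snd c x) = snd d (g x)"
    by (simp add: chart_inv_chart[OF charts_atD[OF c]])
  then have "((k \<circ> chart_inv d) \<circ> (snd d \<circ> g \<circ> chart_inv c) has_derivative K' \<circ> G') (at (snd c x))"
    by (intro diff_chain_at[OF G']) (simp only: K')
  moreover have "\<forall>\<^sub>F y in nhds x. g y \<in> fst d"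
    using eventually_in_chart[OF d] g by (rule eventually_compose_filterlim)
  from eventually_chart_inv[OF c this]
  have "\<forall>\<^sub>F z in nhds (snd c x). ((k \<circ> chart_inv d) \<circ> (snd d \<circ> g \<circ> chart_inv c)) z = (k \<circ> g \<circ> chart_inv c) z"
    by eventually_elim (simp add: chart_inv_chart[OF charts_atD(1)[OF d]])
  then obtain S where "open S" "snd c x \<in> S"
    "\<And>z. z \<in> S \<Longrightarrow> ((k \<circ> chart_inv d) \<circ> (snd d \<circ> g \<circ> chart_inv c)) z = (k \<circ> g \<circ> chart_inv c) z"
    unfolding eventually_nhds by blast
  ultimately show ?thesis by (rule has_derivative_transform_within_open)
qed

end

section \<open>Flows determined by their Koopman eigenfunctions\<close>

text \<open>The trajectories \<open>t \<mapsto> \<psi> t x\<close> are assumed to be continuous. The group law of \<open>\<psi>\<close> and the regularity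
of \<open>\<psi> t\<close> in the space variable are consequences of the eigenfunction equations and of the immersion property.\<close>

locale koopman_flow = smooth_mfd A
  for A :: "('a::{t2_space, second_countable_topology}, 'n::finite) chart set" +
  fixes \<psi> :: "real \<Rightarrow> 'a \<Rightarrow> 'a" and \<phi> :: "'j \<Rightarrow> 'a \<Rightarrow> complex" and \<mu> :: "'j \<Rightarrow> complex" and J :: "'j set"
  assumes fin: "finite J"
    and psi_0: "\<psi> 0 x = x"
    and trajectory: "continuous_on UNIV (\<lambda>t. \<psi> t x)"
    and C1: "j \<in> J \<Longrightarrow> Ck_fun_on A 1 UNIV (\<phi> j)"
    and eigen: "j \<in> J \<Longrightarrow> \<phi> j (\<psi> t x) = exp (\<mu> j * of_real t) * \<phi> j x"
    and immersion: "v \<in> tangent_space A x \<Longrightarrow> (\<And>j. j \<in> J \<Longrightarrow> differential A (\<phi> j) x v = 0) \<Longrightarrow> v = 0"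
begin

text \<open>A left inverse of the differentials at \<open>p\<close> combines the eigenfunctions to a map into the chart whose
derivative at \<open>p\<close> is the identity.\<close>

lemma eigenfunctions_local_coordinates:
  assumes c_def: "c = some_chart A p"
  obtains M \<delta> where "\<And>j. j \<in> J \<Longrightarrow> linear (M j)"
    and "((\<lambda>z. \<Sum>j\<in>J. M j (\<phi> j (chart_inv c z))) has_derivative id)
           (at (snd c p))"
    and "\<delta> > 0" and "ball (snd c p) \<delta> \<subseteq> snd c ` fst c"
    and "\<And>z z'. z \<in> ball (snd c p) \<delta> \<Longrightarrow> z' \<in> ball (snd c p) \<delta> \<Longrightarrow>
      norm (z - z') \<le> 2 * norm ((\<Sum>j\<in>J. M j (\<phi> j (chart_inv c z)))
        - (\<Sum>j\<in>J. M j (\<phi> j (chart_inv c z'))))"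
proof -
  have c: "c \<in> A" "p \<in> fst c" using charts_atD[OF some_chart] by (auto simp: c_def)
  have inj: "u = 0" if u: "\<And>j. j \<in> J \<Longrightarrow> coord_deriv (\<phi> j) p u = 0" for u
  proof -
    have "tangent p u = 0"
      using u by (intro immersion[where x = p] tangent_in) (simp add: differential_eq coord_tangent)
    then show ?thesis using coord_tangent[of p u] by simp
  qed
  obtain M where M: "\<And>j. j \<in> J \<Longrightarrow> linear (M j)"
      "\<And>u. (\<Sum>j\<in>J. M j (coord_deriv (\<phi> j) p u)) = u"
    using joint_left_inverse[where D = "\<lambda>j. coord_deriv (\<phi> j) p", OF fin linear_coord_deriv[OF C1 UNIV_I] inj]
    by blast
  define G where "G z = (\<Sum>j\<in>J. M j (\<phi> j (chart_inv c z)))" for z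
  define G' where "G' z u = (\<Sum>j\<in>J. M j (frechet_derivative (\<phi> j \<circ> chart_inv c) (at z) u))" for z u
  have bl: "bounded_linear (M j)" if "j \<in> J" for j
    using M(1)[OF that] by (simp add: linear_conv_bounded_linear)
  have G_deriv: "(G has_derivative G' z) (at z)" if "z \<in> snd c ` fst c" for z
  proof -
    have "((\<lambda>z. M j ((\<phi> j \<circ> chart_inv c) z)) has_derivative
        (\<lambda>u. M j (frechet_derivative (\<phi> j \<circ> chart_inv c) (at z) u))) (at z)" if "j \<in> J" for j
      using \<open>z \<in> _\<close> by (intro bounded_linear.has_derivative[OF bl[OF that]] C1_in_chart(1)[OF C1[OF that] c(1)]) simp
    then show ?thesis unfolding G_def G'_def by (auto intro!: has_derivative_sum)
  qed
  have G'_cont: "continuous_on (snd c ` fst c) (\<lambda>z. G' z u)" for u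
    unfolding G'_def
  proof (intro continuous_on_sum)
    fix j assume j: "j \<in> J"
    show "continuous_on (snd c ` fst c) (\<lambda>z. M j (frechet_derivative (\<phi> j \<circ> chart_inv c) (at z) u))"
      using bounded_linear.continuous_on[OF bl[OF j] C1_in_chart(2)[OF C1[OF j] c(1), of u]] by simp
  qed
  have G'_id: "G' (snd c p) = id" by (simp add: fun_eq_iff G'_def c_def M(2))
  have p: "snd c p \<in> snd c ` fst c" using c by simp
  show thesis
  proof (rule C1_near_identity_expansive[OF chart_homeo(2)[OF c(1)] p G_deriv G'_cont G'_id])
    fix \<delta> :: real
    assume "\<delta> > 0" "ball (snd c p) \<delta> \<subseteq> snd c ` fst c"
      "\<And>x y. x \<in> ball (snd c p) \<delta> \<Longrightarrow> y \<in> ball (snd c p) \<delta> \<Longrightarrow> norm (x - y) \<le> 2 * norm (G x - G y)"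
    then show thesis
      using G_deriv[OF p] by (intro that[OF M(1)]) (auto simp: c_def[symmetric] G'_id G_def[abs_def])
  qed
qed

lemma eigenfunctions_locally_expansive:
  assumes c_def: "c = some_chart A p" and \<zeta>_def: "\<zeta> = snd c p"
  obtains \<delta> K where "\<delta> > 0" "K \<ge> 0"
    "ball \<zeta> \<delta> \<subseteq> snd c ` fst c"
    "\<And>x y. x \<in> fst c \<Longrightarrow> y \<in> fst c \<Longrightarrow>
      snd c x \<in> ball \<zeta> \<delta> \<Longrightarrow>
      snd c y \<in> ball \<zeta> \<delta> \<Longrightarrow>
      norm (snd c x - snd c y) \<le> K * (\<Sum>j\<in>J. cmod (\<phi> j x - \<phi> j y))"
proof -
  have c: "c \<in> A" "p \<in> fst c" using charts_atD[OF some_chart] by (auto simp: c_def)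
  obtain M \<delta> where M: "\<And>j. j \<in> J \<Longrightarrow> linear (M j)"
    and "((\<lambda>z. \<Sum>j\<in>J. M j (\<phi> j (chart_inv c z))) has_derivative id) (at \<zeta>)"
    and \<delta>: "\<delta> > 0" "ball \<zeta> \<delta> \<subseteq> snd c ` fst c"
    and exp: "\<And>z z'. z \<in> ball \<zeta> \<delta> \<Longrightarrow> z' \<in> ball \<zeta> \<delta> \<Longrightarrow>
      norm (z - z') \<le> 2 * norm ((\<Sum>j\<in>J. M j (\<phi> j (chart_inv c z))) - (\<Sum>j\<in>J. M j (\<phi> j (chart_inv c z'))))"
    unfolding \<zeta>_def by (rule eigenfunctions_local_coordinates[OF c_def]) (rule that[unfolded \<zeta>_def])
  define K where "K = 2 * (\<Sum>j\<in>J. onorm (M j))"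
  have bl: "bounded_linear (M j)" if "j \<in> J" for j
    using M[OF that] by (simp add: linear_conv_bounded_linear)
  have on: "0 \<le> onorm (M j)" if "j \<in> J" for j using onorm_pos_le[OF bl[OF that]] .
  show thesis
  proof (rule that[OF \<delta>(1)])
    show "K \<ge> 0" unfolding K_def using on by (simp add: sum_nonneg)
    show "ball \<zeta> \<delta> \<subseteq> snd c ` fst c" by (rule \<delta>(2))
    fix x y assume xy: "x \<in> fst c" "y \<in> fst c" "snd c x \<in> ball \<zeta> \<delta>" "snd c y \<in> ball \<zeta> \<delta>"
    have "norm (snd c x - snd c y) \<le> 2 * norm ((\<Sum>j\<in>J. M j (\<phi> j x)) - (\<Sum>j\<in>J. M j (\<phi> j y)))"
      using exp[OF xy(3,4)] by (simp add: chart_inv_chart[OF c(1)] xy)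
    also have "(\<Sum>j\<in>J. M j (\<phi> j x)) - (\<Sum>j\<in>J. M j (\<phi> j y)) = (\<Sum>j\<in>J. M j (\<phi> j x - \<phi> j y))"
      by (simp add: sum_subtractf[symmetric] linear_diff[OF M])
    also have "norm \<dots> \<le> (\<Sum>j\<in>J. onorm (M j) * (\<Sum>i\<in>J. cmod (\<phi> i x - \<phi> i y)))"
    proof (rule sum_norm_le)
      fix j assume j: "j \<in> J"
      have "norm (M j (\<phi> j x - \<phi> j y)) \<le> onorm (M j) * cmod (\<phi> j x - \<phi> j y)" by (rule onorm[OF bl[OF j]])
      also have "\<dots> \<le> onorm (M j) * (\<Sum>i\<in>J. cmod (\<phi> i x - \<phi> i y))"
        using j fin on[OF j] by (intro mult_left_mono member_le_sum) auto
      finally show "norm (M j (\<phi> j x - \<phi> j y)) \<le> \<dots>" .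
    qed
    finally show "norm (snd c x - snd c y) \<le> K * (\<Sum>j\<in>J. cmod (\<phi> j x - \<phi> j y))"
      by (simp add: K_def mult.assoc flip: sum_distrib_right)
  qed
qed

text \<open>The set of times at which the curves agree is closed because the space is Hausdorff, and open because
the eigenfunctions are locally jointly injective.\<close>

lemma lifted_path_unique:
  assumes cont: "continuous_on UNIV (\<gamma>\<^sub>1 :: real \<Rightarrow> 'a)" "continuous_on UNIV \<gamma>\<^sub>2"
    and init: "\<gamma>\<^sub>1 0 = \<gamma>\<^sub>2 0"
    and eq: "\<And>j s. j \<in> J \<Longrightarrow> \<phi> j (\<gamma>\<^sub>1 s) = \<phi> j (\<gamma>\<^sub>2 s)"
  shows "\<gamma>\<^sub>1 s = \<gamma>\<^sub>2 s"
proof -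
  let ?S = "{s. \<gamma>\<^sub>1 s = \<gamma>\<^sub>2 s}"
  have "closed ?S" using cont by (rule closed_Collect_eq)
  moreover have "open ?S"
  proof (rule Topological_Spaces.openI)
    fix s assume s: "s \<in> ?S"
    define c where "c = some_chart A (\<gamma>\<^sub>1 s)"
    have c: "c \<in> A" "\<gamma>\<^sub>1 s \<in> fst c" using charts_atD[OF some_chart] by (auto simp: c_def)
    obtain \<delta> K where \<delta>: "\<delta> > 0" and "K \<ge> 0" "ball (snd c (\<gamma>\<^sub>1 s)) \<delta> \<subseteq> snd c ` fst c" and exp: "\<And>x y. x \<in> fst c \<Longrightarrow> y \<in> fst c \<Longrightarrow>
      snd c x \<in> ball (snd c (\<gamma>\<^sub>1 s)) \<delta> \<Longrightarrow> snd c y \<in> ball (snd c (\<gamma>\<^sub>1 s)) \<delta> \<Longrightarrow>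
      norm (snd c x - snd c y) \<le> K * (\<Sum>j\<in>J. cmod (\<phi> j x - \<phi> j y))"
      by (rule eigenfunctions_locally_expansive[OF c_def refl]) (rule that)
    define V where "V = {y \<in> fst c. snd c y \<in> ball (snd c (\<gamma>\<^sub>1 s)) \<delta>}"
    have "open V" unfolding V_def by (intro open_chart_preimage c open_ball)
    then have "open (\<gamma>\<^sub>1 -` V \<inter> \<gamma>\<^sub>2 -` V)" using cont by (intro open_Int open_vimage)
    moreover have "s \<in> \<gamma>\<^sub>1 -` V \<inter> \<gamma>\<^sub>2 -` V" using s c \<delta> by (auto simp: V_def)
    moreover have "\<gamma>\<^sub>1 -` V \<inter> \<gamma>\<^sub>2 -` V \<subseteq> ?S"
    proof
      fix t assume t: "t \<in> \<gamma>\<^sub>1 -` V \<inter> \<gamma>\<^sub>2 -` V"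
      then have "norm (snd c (\<gamma>\<^sub>1 t) - snd c (\<gamma>\<^sub>2 t)) \<le> K * (\<Sum>j\<in>J. cmod (\<phi> j (\<gamma>\<^sub>1 t) - \<phi> j (\<gamma>\<^sub>2 t)))"
        by (intro exp) (auto simp: V_def)
      then have "snd c (\<gamma>\<^sub>1 t) = snd c (\<gamma>\<^sub>2 t)" by (simp add: eq)
      moreover have "\<gamma>\<^sub>1 t \<in> fst c" "\<gamma>\<^sub>2 t \<in> fst c" using t by (auto simp: V_def)
      ultimately have "\<gamma>\<^sub>1 t = \<gamma>\<^sub>2 t" by (metis chart_inv_chart[OF c(1)])
      then show "t \<in> ?S" by simp
    qed
    ultimately show "\<exists>T. open T \<and> s \<in> T \<and> T \<subseteq> ?S" by blast
  qed
  ultimately have "?S = {} \<or> ?S = UNIV" using clopen[of ?S] by blast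
  then show ?thesis using init by blast
qed

text \<open>The curves \<open>s \<mapsto> \<psi> s (\<psi> (- t) x)\<close> and \<open>s \<mapsto> \<psi> (s - t) x\<close> start at the same point, and the eigenfunctions
take the same values along them.\<close>

lemma flow_backward_forward: "\<psi> t (\<psi> (- t) x) = x"
proof -
  have "\<psi> t (\<psi> (- t) x) = \<psi> (t - t) x"
  proof (rule lifted_path_unique[where \<gamma>\<^sub>1 = "\<lambda>s. \<psi> s (\<psi> (- t) x)" and \<gamma>\<^sub>2 = "\<lambda>s. \<psi> (s - t) x", OF trajectory])
    show "continuous_on UNIV (\<lambda>s. \<psi> (s - t) x)"
      by (rule continuous_on_compose2[OF trajectory, of UNIV "\<lambda>s. s - t"]) (auto intro!: continuous_intros)
    show "\<psi> 0 (\<psi> (- t) x) = \<psi> (0 - t) x" by (simp add: psi_0)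
    show "\<phi> j (\<psi> s (\<psi> (- t) x)) = \<phi> j (\<psi> (s - t) x)" if "j \<in> J" for j s
    proof -
      have "exp (\<mu> j * of_real s) * exp (\<mu> j * of_real (- t)) = exp (\<mu> j * of_real (s - t))"
        by (simp add: mult_exp_exp right_diff_distrib)
      then show ?thesis by (simp only: eigen[OF that] mult.assoc[symmetric])
    qed
  qed
  then show ?thesis by (simp add: psi_0)
qed

text \<open>For times \<open>s\<close> near \<open>s\<^sub>0\<close> the point \<open>\<psi> s x\<close> stays in the half-size chart ball around \<open>\<psi> s\<^sub>0 x\<close>. While \<open>\<psi> s y\<close> is
in the full ball, expansivity bounds its chart distance to \<open>\<psi> s x\<close> by a multiple \<open>B y\<close> of the distances
\<open>|\<phi> j y - \<phi> j x|\<close>, uniformly in \<open>s\<close>. If \<open>y\<close> is so close to \<open>x\<close> that \<open>B y\<close> is small, then \<open>\<psi> s y\<close> cannot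
cross the shell between the radii \<open>3 \<delta> / 4\<close> and \<open>\<delta>\<close>; so it stays in the ball for all these times if it
is there once.\<close>

lemma flow_tendsto_locally_constant:
  obtains \<eta> where "\<eta> > 0"
    "\<And>s s'. s \<in> ball s\<^sub>0 \<eta> \<Longrightarrow> s' \<in> ball s\<^sub>0 \<eta> \<Longrightarrow> (\<psi> s' \<longlongrightarrow> \<psi> s' x) (nhds x) \<Longrightarrow> (\<psi> s \<longlongrightarrow> \<psi> s x) (nhds x)"
proof -
  define p where "p = \<psi> s\<^sub>0 x"
  define c where "c = some_chart A p"
  define \<zeta> where "\<zeta> = snd c p"
  have c: "c \<in> A" "p \<in> fst c" using charts_atD[OF some_chart] by (auto simp: c_def)
  obtain \<delta> K where \<delta>: "\<delta> > 0" and K: "K \<ge> 0" and sub: "ball \<zeta> \<delta> \<subseteq> snd c ` fst c"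
    and exp: "\<And>x y. x \<in> fst c \<Longrightarrow> y \<in> fst c \<Longrightarrow> snd c x \<in> ball \<zeta> \<delta> \<Longrightarrow> snd c y \<in> ball \<zeta> \<delta> \<Longrightarrow>
      norm (snd c x - snd c y) \<le> K * (\<Sum>j\<in>J. cmod (\<phi> j x - \<phi> j y))"
    by (rule eigenfunctions_locally_expansive[OF c_def \<zeta>_def]) (rule that)
  define V where "V r = {y \<in> fst c. snd c y \<in> ball \<zeta> r}" for r
  have V_open: "open (V r)" for r unfolding V_def by (intro open_chart_preimage c open_ball)
  have V_mono: "V r \<subseteq> V s" if "r \<le> s" for r s using that by (auto simp: V_def)
  \<comment> \<open>The closed chart ball is compact, hence closed in the manifold: a trajectory cannot escape to a point
    outside the chart domain.\<close>
  define W where "W = chart_inv c ` cball \<zeta> (3 * \<delta> / 4)"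
  have cball_sub: "cball \<zeta> (3 * \<delta> / 4) \<subseteq> ball \<zeta> \<delta>" using \<delta> by auto
  have "compact W"
    unfolding W_def using chart_homeo(3)[OF c(1)] cball_sub sub
    by (intro compact_continuous_image compact_cball) (auto simp: homeomorphism_def intro: continuous_on_subset)
  then have W_closed: "closed W" by (rule compact_imp_closed)
  have W_V: "W \<subseteq> V \<delta>"
  proof
    fix y assume "y \<in> W"
    then obtain z where z: "z \<in> cball \<zeta> (3 * \<delta> / 4)" "y = chart_inv c z" by (auto simp: W_def)
    then have "z \<in> snd c ` fst c" "z \<in> ball \<zeta> \<delta>" using cball_sub sub by blast+
    then show "y \<in> V \<delta>" using chart_chart_inv[OF c(1)] z(2) by (simp add: V_def)
  qed
  have V_W: "V (3 * \<delta> / 4) \<subseteq> W"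
  proof
    fix y assume "y \<in> V (3 * \<delta> / 4)"
    then have "y = chart_inv c (snd c y)" "snd c y \<in> cball \<zeta> (3 * \<delta> / 4)"
      by (auto simp: V_def chart_inv_chart[OF c(1)])
    then show "y \<in> W" unfolding W_def by blast
  qed
  have "open ((\<lambda>s. \<psi> s x) -` V (\<delta> / 2))" by (rule open_vimage[OF V_open trajectory])
  moreover have "s\<^sub>0 \<in> (\<lambda>s. \<psi> s x) -` V (\<delta> / 2)" using c \<delta> by (simp add: V_def p_def[symmetric] \<zeta>_def)
  ultimately obtain \<eta> where "\<eta> > 0" "ball s\<^sub>0 \<eta> \<subseteq> (\<lambda>s. \<psi> s x) -` V (\<delta> / 2)"
    unfolding open_contains_ball by blast
  then have \<eta>: "\<eta> > 0" "\<And>s. s \<in> ball s\<^sub>0 \<eta> \<Longrightarrow> \<psi> s x \<in> V (\<delta> / 2)" by auto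
  define E where "E j = exp (cmod (\<mu> j) * (\<bar>s\<^sub>0\<bar> + \<eta>))" for j
  define B where "B y = K * (\<Sum>j\<in>J. E j * cmod (\<phi> j y - \<phi> j x))" for y
  have B: "norm (snd c (\<psi> s y) - snd c (\<psi> s x)) \<le> B y" if s: "s \<in> ball s\<^sub>0 \<eta>" and y: "\<psi> s y \<in> V \<delta>" for s y
  proof -
    have "\<psi> s x \<in> V \<delta>" using \<eta>(2)[OF s] V_mono[of "\<delta> / 2" \<delta>] \<delta> by auto
    then have "norm (snd c (\<psi> s y) - snd c (\<psi> s x)) \<le> K * (\<Sum>j\<in>J. cmod (\<phi> j (\<psi> s y) - \<phi> j (\<psi> s x)))"
      using y by (intro exp) (auto simp: V_def)
    also have "\<dots> \<le> B y"
      unfolding B_def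
    proof (intro mult_left_mono[OF _ K] sum_mono)
      fix j assume j: "j \<in> J"
      have "\<bar>s\<bar> \<le> \<bar>s\<^sub>0\<bar> + \<eta>" using s by (auto simp: dist_real_def)
      then have "cmod (exp (\<mu> j * of_real s)) \<le> E j"
        unfolding E_def by (intro order_trans[OF norm_exp]) (simp add: norm_mult mult_left_mono)
      then have "cmod (exp (\<mu> j * of_real s)) * cmod (\<phi> j y - \<phi> j x) \<le> E j * cmod (\<phi> j y - \<phi> j x)"
        by (rule mult_right_mono) simp
      then show "cmod (\<phi> j (\<psi> s y) - \<phi> j (\<psi> s x)) \<le> E j * cmod (\<phi> j y - \<phi> j x)"
        by (simp only: eigen[OF j] right_diff_distrib[symmetric] norm_mult)
    qed
    finally show ?thesis .
  qed
  have "(B \<longlongrightarrow> K * (\<Sum>j\<in>J. E j * cmod (\<phi> j x - \<phi> j x))) (nhds x)"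
    unfolding B_def by (intro tendsto_intros C1_tendsto[OF C1]) auto
  then have B_lim: "(B \<longlongrightarrow> 0) (nhds x)" by simp
  show thesis
  proof (rule that[OF \<eta>(1)])
    fix s s' assume s: "s \<in> ball s\<^sub>0 \<eta>" and s': "s' \<in> ball s\<^sub>0 \<eta>" and lim: "(\<psi> s' \<longlongrightarrow> \<psi> s' x) (nhds x)"
    have "\<psi> s' x \<in> V (3 * \<delta> / 4)" using \<eta>(2)[OF s'] V_mono[of "\<delta> / 2" "3 * \<delta> / 4"] \<delta> by auto
    then have "\<forall>\<^sub>F y in nhds x. \<psi> s' y \<in> V (3 * \<delta> / 4)"
      using lim V_open by (simp add: topological_tendstoD)
    moreover have "\<forall>\<^sub>F y in nhds x. B y < \<delta> / 4"
      using order_tendstoD(2)[OF B_lim, of "\<delta> / 4"] \<delta> by simp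
    ultimately have stay: "\<forall>\<^sub>F y in nhds x. \<psi> s y \<in> V \<delta>"
    proof eventually_elim
      case (elim y)
      let ?I = "ball s\<^sub>0 \<eta>"
      \<comment> \<open>A trajectory in the closed ball is already in the open one, so the times spent there are clopen.\<close>
      have "\<psi> t y \<in> V (3 * \<delta> / 4)" if t: "t \<in> ?I" "\<psi> t y \<in> W" for t
      proof -
        have y: "\<psi> t y \<in> V \<delta>" using t W_V by auto
        have "norm (\<zeta> - snd c (\<psi> t y)) \<le> norm (\<zeta> - snd c (\<psi> t x)) + norm (snd c (\<psi> t y) - snd c (\<psi> t x))"
          using norm_triangle_ineq4[of "\<zeta> - snd c (\<psi> t x)" "snd c (\<psi> t y) - snd c (\<psi> t x)"] by simp
        also have "\<dots> < \<delta> / 2 + \<delta> / 4"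
          using \<eta>(2)[OF t(1)] B[OF t(1) y] elim(2) by (auto simp: V_def dist_norm)
        finally show ?thesis using y by (simp add: V_def dist_norm)
      qed
      then have Z: "?I \<inter> (\<lambda>t. \<psi> t y) -` W = ?I \<inter> (\<lambda>t. \<psi> t y) -` V (3 * \<delta> / 4)" using V_W by blast
      have "closedin (top_of_set ?I) (?I \<inter> (\<lambda>t. \<psi> t y) -` W)"
        by (intro closedin_closed_Int closed_vimage W_closed trajectory)
      moreover have "openin (top_of_set ?I) (?I \<inter> (\<lambda>t. \<psi> t y) -` W)"
        unfolding Z by (intro openin_open_Int open_vimage V_open trajectory)
      moreover have "s' \<in> ?I \<inter> (\<lambda>t. \<psi> t y) -` W" using s' elim(1) V_W by blast
      ultimately have "?I \<inter> (\<lambda>t. \<psi> t y) -` W = ?I"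
        using connected_clopen[of ?I] connected_ball[of s\<^sub>0 \<eta>] by blast
      then show "\<psi> s y \<in> V \<delta>" using s W_V by blast
    qed
    have "\<forall>\<^sub>F y in nhds x. norm (snd c (\<psi> s y) - snd c (\<psi> s x)) \<le> B y"
      using stay by eventually_elim (rule B[OF s])
    then have "((\<lambda>y. snd c (\<psi> s y) - snd c (\<psi> s x)) \<longlongrightarrow> 0) (nhds x)"
      using B_lim by (rule Lim_null_comparison)
    then have "((\<lambda>y. snd c (\<psi> s y)) \<longlongrightarrow> snd c (\<psi> s x)) (nhds x)" by (rule LIM_zero_cancel)
    moreover have "c \<in> charts_at A (\<psi> s x)" using \<eta>(2)[OF s] c by (simp add: V_def charts_at_def)
    ultimately have "((\<lambda>y. chart_inv c (snd c (\<psi> s y))) \<longlongrightarrow> \<psi> s x) (nhds x)"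
      by (intro filterlim_compose[OF tendsto_chart_inv])
    moreover have "\<forall>\<^sub>F y in nhds x. chart_inv c (snd c (\<psi> s y)) = \<psi> s y"
      using stay by eventually_elim (simp add: V_def chart_inv_chart[OF c(1)])
    ultimately show "(\<psi> s \<longlongrightarrow> \<psi> s x) (nhds x)" by (rule Lim_transform_eventually)
  qed
qed

lemma flow_tendsto: "(\<psi> t \<longlongrightarrow> \<psi> t x) (nhds x)"
proof -
  let ?S = "{s. (\<psi> s \<longlongrightarrow> \<psi> s x) (nhds x)}"
  have "open ?S"
  proof (rule Topological_Spaces.openI)
    fix s assume s: "s \<in> ?S"
    obtain \<eta> where "\<eta> > 0" "\<And>t s'. t \<in> ball s \<eta> \<Longrightarrow> s' \<in> ball s \<eta> \<Longrightarrow> s' \<in> ?S \<Longrightarrow> t \<in> ?S"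
      using flow_tendsto_locally_constant[of s x] by (metis (no_types, lifting) mem_Collect_eq)
    then show "\<exists>T. open T \<and> s \<in> T \<and> T \<subseteq> ?S"
      using s by (intro exI[of _ "ball s \<eta>"]) (meson centre_in_ball open_ball subsetI)
  qed
  moreover have "open (- ?S)"
  proof (rule Topological_Spaces.openI)
    fix s assume s: "s \<in> - ?S"
    obtain \<eta> where "\<eta> > 0" "\<And>t s'. t \<in> ball s \<eta> \<Longrightarrow> s' \<in> ball s \<eta> \<Longrightarrow> s' \<in> ?S \<Longrightarrow> t \<in> ?S"
      using flow_tendsto_locally_constant[of s x] by (metis (no_types, lifting) mem_Collect_eq)
    then show "\<exists>T. open T \<and> s \<in> T \<and> T \<subseteq> - ?S"
      using s by (intro exI[of _ "ball s \<eta>"]) (meson ComplD ComplI centre_in_ball open_ball subsetI)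
  qed
  ultimately have "?S = {} \<or> ?S = UNIV" using clopen[of ?S] by (simp add: closed_def)
  moreover have "0 \<in> ?S" by (simp add: psi_0[abs_def] filterlim_ident)
  ultimately show ?thesis by blast
qed

text \<open>In the chart at \<open>\<psi> t x\<close> let \<open>G\<close> be the combination of the eigenfunctions with derivative \<open>id\<close>. Composed with
the flow it is the same combination of \<open>exp (\<mu> j * t) * \<phi> j\<close>, which is differentiable at \<open>x\<close>; the continuous
map \<open>\<psi> t\<close> is its lift through \<open>G\<close>.\<close>

lemma flow_has_derivative_in_charts:
  obtains H' where "(snd (some_chart A (\<psi> t x)) \<circ> \<psi> t \<circ> chart_inv (some_chart A x) has_derivative H')
     (at (snd (some_chart A x) x))"
proof -
  define c where "c = some_chart A x"
  define d where "d = some_chart A (\<psi> t x)"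
  have c: "c \<in> charts_at A x" and d: "d \<in> charts_at A (\<psi> t x)" by (simp_all add: c_def d_def some_chart)
  have cx: "chart_inv c (snd c x) = x" by (rule chart_inv_chart[OF charts_atD[OF c]])
  obtain M where M: "\<And>j. j \<in> J \<Longrightarrow> linear (M j)"
    and G: "((\<lambda>z. \<Sum>j\<in>J. M j (\<phi> j (chart_inv d z))) has_derivative id) (at (snd d (\<psi> t x)))"
    by (rule eigenfunctions_local_coordinates[OF d_def]) (rule that)
  define h where "h = snd d \<circ> \<psi> t \<circ> chart_inv c"
  have "((\<lambda>z. M j (exp (\<mu> j * of_real t) * (\<phi> j \<circ> chart_inv c) z)) has_derivative
      (\<lambda>u. M j (exp (\<mu> j * of_real t) * coord_deriv (\<phi> j) x u))) (at (snd c x))" if "j \<in> J" for j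
  proof -
    have bl: "bounded_linear (M j)" using M[OF that] by (simp add: linear_conv_bounded_linear)
    have "(\<phi> j \<circ> chart_inv c has_derivative coord_deriv (\<phi> j) x) (at (snd c x))"
      unfolding c_def by (rule has_derivative_coord_deriv[OF C1[OF that] UNIV_I])
    from bounded_linear.has_derivative[OF bl has_derivative_mult_right[OF this]] show ?thesis .
  qed
  then have H: "((\<lambda>z. \<Sum>j\<in>J. M j (exp (\<mu> j * of_real t) * (\<phi> j \<circ> chart_inv c) z)) has_derivative
      (\<lambda>u. \<Sum>j\<in>J. M j (exp (\<mu> j * of_real t) * coord_deriv (\<phi> j) x u))) (at (snd c x))"
    by (rule has_derivative_sum)
  have "(h has_derivative (\<lambda>u. \<Sum>j\<in>J. M j (exp (\<mu> j * of_real t) * coord_deriv (\<phi> j) x u))) (at (snd c x))"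
  proof (rule has_derivative_of_lift[OF _ H])
    show "((\<lambda>z. \<Sum>j\<in>J. M j (\<phi> j (chart_inv d z))) has_derivative id) (at (h (snd c x)))"
      using G by (simp add: h_def cx)
    have "\<forall>\<^sub>F y in nhds x. \<psi> t y \<in> fst d"
      using eventually_in_chart[OF d] flow_tendsto[of t x] by (rule eventually_compose_filterlim)
    from eventually_chart_inv[OF c this]
    show "\<forall>\<^sub>F z in nhds (snd c x). (\<Sum>j\<in>J. M j (\<phi> j (chart_inv d (h z)))) =
        (\<Sum>j\<in>J. M j (exp (\<mu> j * of_real t) * (\<phi> j \<circ> chart_inv c) z))"
      by eventually_elim (simp add: h_def chart_inv_chart[OF charts_atD(1)[OF d]] eigen)
    have "((\<lambda>z. snd d (\<psi> t (chart_inv c z))) \<longlongrightarrow> snd d (\<psi> t x)) (nhds (snd c x))"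
      by (intro filterlim_compose[OF tendsto_chart[OF d]] filterlim_compose[OF flow_tendsto] tendsto_chart_inv[OF c])
    then show "(h \<longlongrightarrow> h (snd c x)) (nhds (snd c x))" by (simp add: h_def o_def cx)
  qed
  then show thesis using that by (simp add: h_def c_def d_def)
qed

text \<open>The second part is the derivative of the eigenfunction equation \<open>\<phi> j \<circ> \<psi> t = exp (\<mu> j * t) * \<phi> j\<close>.\<close>

lemma
  assumes v: "v \<in> tangent_space A x"
  shows tangent_map_in: "tangent_map A (\<psi> t) x v \<in> tangent_space A (\<psi> t x)"
    and differential_tangent_map: "j \<in> J \<Longrightarrow>
      differential A (\<phi> j) (\<psi> t x) (tangent_map A (\<psi> t) x v) = exp (\<mu> j * of_real t) * differential A (\<phi> j) x v"
proof -
  define c where "c = some_chart A x"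
  define d where "d = some_chart A (\<psi> t x)"
  have c: "c \<in> charts_at A x" and d: "d \<in> charts_at A (\<psi> t x)" by (simp_all add: c_def d_def some_chart)
  obtain H' where H': "(snd d \<circ> \<psi> t \<circ> chart_inv c has_derivative H') (at (snd c x))"
    using flow_has_derivative_in_charts[of t x] unfolding c_def d_def by blast
  note chain = has_derivative_comp_chart[OF c d flow_tendsto H']
  define w where "w = tangent_map A (\<psi> t) x v"
  have w: "w e = transition_deriv d e (\<psi> t x) (H' (v c))" if e: "e \<in> charts_at A (\<psi> t x)" for e
    using fun_cong[OF frechet_derivative_at[OF chain[OF has_derivative_transition[OF d e]]], of "v c"] e
    by (simp add: w_def tangent_map_def Let_def c_def)
  show "tangent_map A (\<psi> t) x v \<in> tangent_space A (\<psi> t x)"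
    unfolding w_def[symmetric]
  proof (rule tangent_spaceI)
    show "w e = 0" if "e \<notin> charts_at A (\<psi> t x)" for e using that by (simp add: w_def tangent_map_def)
  qed (simp add: w transition_cocycle[OF d])
  assume j: "j \<in> J"
  have wd: "w d = H' (v c)" by (simp add: w d transition_self)
  have "(\<phi> j \<circ> \<psi> t \<circ> chart_inv c has_derivative coord_deriv (\<phi> j) (\<psi> t x) \<circ> H') (at (snd c x))"
    by (rule chain) (unfold d_def, rule has_derivative_coord_deriv[OF C1[OF j] UNIV_I])
  moreover have "\<phi> j \<circ> \<psi> t \<circ> chart_inv c = (\<lambda>z. exp (\<mu> j * of_real t) * (\<phi> j \<circ> chart_inv c) z)"
    using j by (simp add: fun_eq_iff eigen)
  moreover have "((\<lambda>z. exp (\<mu> j * of_real t) * (\<phi> j \<circ> chart_inv c) z) has_derivative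
      (\<lambda>u. exp (\<mu> j * of_real t) * coord_deriv (\<phi> j) x u)) (at (snd c x))"
    unfolding c_def by (intro has_derivative_mult_right has_derivative_coord_deriv[OF C1[OF j] UNIV_I])
  ultimately have "coord_deriv (\<phi> j) (\<psi> t x) \<circ> H' = (\<lambda>u. exp (\<mu> j * of_real t) * coord_deriv (\<phi> j) x u)"
    by (metis has_derivative_unique)
  then have "coord_deriv (\<phi> j) (\<psi> t x) (H' (v c)) = exp (\<mu> j * of_real t) * coord_deriv (\<phi> j) x (v c)"
    by (simp add: fun_eq_iff)
  then show "differential A (\<phi> j) (\<psi> t x) (tangent_map A (\<psi> t) x v) = exp (\<mu> j * of_real t) * differential A (\<phi> j) x v"
    unfolding differential_eq w_def[symmetric] by (simp add: wd c_def[symmetric] d_def[symmetric])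
qed

end

section \<open>Cones dominated by one eigenfunction\<close>

context smooth_mfd
begin

lemma continuous_on_coord: "continuous_on UNIV (\<lambda>v :: ('a, 'n) tvec. coord x v)"
  by (rule continuous_on_product_coordinates)

lemma continuous_on_linear_coord:
  fixes g :: "real^'n \<Rightarrow> 'b::real_normed_vector"
  assumes "linear g"
  shows "continuous_on UNIV (\<lambda>v :: ('a, 'n) tvec. g (coord x v))"
  using assms linear_continuous_on[of g UNIV]
  by (intro continuous_on_compose2[OF _ continuous_on_coord]) (auto simp: linear_conv_bounded_linear)

text \<open>The topology of the tangent space is not discrete: if 0 is the interior point at hand, a small multiple
of any nonzero tangent vector is in the set as well.\<close>

lemma nonzero_of_interior:
  assumes "tangent_interior A x S \<noteq> {}"
  obtains v where "v \<in> S" "v \<in> tangent_space A x" "v \<noteq> 0"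
proof -
  obtain V v where V: "open V" and v: "v \<in> V" "v \<in> tangent_space A x"
    and sub: "tangent_space A x \<inter> V \<subseteq> S"
    using assms unfolding tangent_interior_def interior_of_def by (auto simp: openin_open)
  show thesis
  proof (cases "v = 0")
    case False
    then show thesis using that v sub by blast
  next
    case True
    define w where "w = tangent x (SOME i. i \<in> Basis)"
    have "(SOME i :: real^'n. i \<in> Basis) \<in> Basis" by (rule SOME_Basis)
    then have w: "coord x w \<noteq> 0" "w \<in> tangent_space A x"
      by (auto simp: w_def coord_tangent tangent_in)
    have "continuous_on UNIV (\<lambda>s :: real. s *\<^sub>R w)"
      by (rule continuous_on_coordinatewise_then_product) (auto simp: scaleR_fun_def intro!: continuous_intros)
    then have "open ((\<lambda>s :: real. s *\<^sub>R w) -` V)" using V by (intro open_vimage)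
    moreover have "0 \<in> (\<lambda>s :: real. s *\<^sub>R w) -` V" using v True by simp
    ultimately obtain e where e: "e > 0" "ball 0 e \<subseteq> (\<lambda>s :: real. s *\<^sub>R w) -` V"
      unfolding open_contains_ball by blast
    then have "(e / 2) *\<^sub>R w \<in> V" by (auto simp: subset_iff)
    moreover have "(e / 2) *\<^sub>R w \<in> tangent_space A x" using w by (intro tangent_space_lin)
    moreover have "coord x ((e / 2) *\<^sub>R w) \<noteq> 0" using e w by (simp add: scaleR_fun_def)
    then have "(e / 2) *\<^sub>R w \<noteq> 0" by (metis coord_lin(1))
    ultimately show thesis using that sub by blast
  qed
qed

end

text \<open>Both cones of the theorem are instances: \<open>\<alpha>\<close> is the differential of the dominant eigenfunction, or of its
argument, in coordinates, \<open>r\<close> is its growth rate, and \<open>I\<close> indexes the other eigenfunctions.\<close>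

locale koopman_cone = koopman_flow A \<psi> \<phi> \<mu> J
  for A :: "('a::{t2_space, second_countable_topology}, 'n::finite) chart set"
    and \<psi> :: "real \<Rightarrow> 'a \<Rightarrow> 'a" and \<phi> :: "'j \<Rightarrow> 'a \<Rightarrow> complex" and \<mu> :: "'j \<Rightarrow> complex" and J :: "'j set" +
  fixes I :: "'j set" and r :: real and \<alpha> :: "'a \<Rightarrow> real^'n \<Rightarrow> real"
  assumes I: "I \<subseteq> J" "I \<noteq> {}"
    and linear_\<alpha>: "linear (\<alpha> x)"
    and \<alpha>_flow: "v \<in> tangent_space A x \<Longrightarrow>
      \<alpha> (\<psi> t x) (coord (\<psi> t x) (tangent_map A (\<psi> t) x v)) = exp (r * t) * \<alpha> x (coord x v)"
    and rate: "j \<in> I \<Longrightarrow> Re (\<mu> j) \<le> r"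
    and definite: "\<alpha> x u = 0 \<Longrightarrow> (\<And>j. j \<in> I \<Longrightarrow> coord_deriv (\<phi> j) x u = 0) \<Longrightarrow> u = 0"
begin

lemma fin_I: "finite I" using I fin finite_subset by blast

lemma linear_deriv: "j \<in> I \<Longrightarrow> linear (coord_deriv (\<phi> j) x)"
  using linear_coord_deriv[OF C1 UNIV_I] I by blast

definition cone :: "real \<Rightarrow> ('a, 'n) cones"
  where "cone \<rho> x = {v \<in> tangent_space A x.
    \<forall>j\<in>I. cmod (differential A (\<phi> j) x v) \<le> \<rho> * \<alpha> x (coord x v)}"

lemma cone_\<alpha>_nonneg:
  assumes "\<rho> > 0" "v \<in> cone \<rho> x"
  shows "0 \<le> \<alpha> x (coord x v)"
proof -
  obtain j where "j \<in> I" using I by blast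
  then have "0 \<le> \<rho> * \<alpha> x (coord x v)" using assms(2) order_trans[OF norm_ge_zero] by (auto simp: cone_def)
  then show ?thesis using assms(1) by (simp add: zero_le_mult_iff)
qed

lemma cone_zero_iff:
  assumes "v \<in> cone \<rho> x"
  shows "\<alpha> x (coord x v) = 0 \<longleftrightarrow> v = 0"
proof
  assume 0: "\<alpha> x (coord x v) = 0"
  have "coord x v = 0"
    using assms by (intro definite[OF 0]) (auto simp: cone_def 0 differential_eq)
  then show "v = 0" using assms coord_inject[OF _ tangent_space_lin(1), of v x] by (auto simp: cone_def)
qed (simp add: linear_0[OF linear_\<alpha>])

lemma zero_in_cone: "0 \<in> cone \<rho> x"
  by (simp add: cone_def tangent_space_lin differential_eq linear_0[OF linear_\<alpha>] linear_0[OF linear_deriv])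

text \<open>The linearised flow multiplies \<open>|b\<^sub>j|\<close> by \<open>exp (Re (\<mu> j) * t)\<close> and \<open>\<alpha>\<close> by \<open>exp (r * t)\<close>, so each ratio is
multiplied by the quotient of the two.\<close>

lemma flow_contracts_cone:
  assumes \<rho>: "\<rho> > 0" and v: "v \<in> cone \<rho> x"
    and contr: "\<And>j. j \<in> I \<Longrightarrow> exp ((Re (\<mu> j) - r) * t) * \<rho> \<le> \<rho>'"
  shows "tangent_map A (\<psi> t) x v \<in> cone \<rho>' (\<psi> t x)"
proof -
  have vT: "v \<in> tangent_space A x" using v by (simp add: cone_def)
  have "cmod (differential A (\<phi> j) (\<psi> t x) (tangent_map A (\<psi> t) x v))
      \<le> \<rho>' * \<alpha> (\<psi> t x) (coord (\<psi> t x) (tangent_map A (\<psi> t) x v))" if j: "j \<in> I" for j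
  proof -
    have "cmod (differential A (\<phi> j) (\<psi> t x) (tangent_map A (\<psi> t) x v))
        = exp (Re (\<mu> j) * t) * cmod (differential A (\<phi> j) x v)"
      using j I differential_tangent_map[OF vT, of j t] by (simp add: norm_mult subset_iff)
    also have "\<dots> \<le> exp (Re (\<mu> j) * t) * (\<rho> * \<alpha> x (coord x v))"
      using v j by (intro mult_left_mono) (auto simp: cone_def)
    also have "exp (Re (\<mu> j) * t) = exp ((Re (\<mu> j) - r) * t) * exp (r * t)"
      by (simp add: mult_exp_exp algebra_simps)
    also have "exp ((Re (\<mu> j) - r) * t) * exp (r * t) * (\<rho> * \<alpha> x (coord x v))
        = exp ((Re (\<mu> j) - r) * t) * \<rho> * (exp (r * t) * \<alpha> x (coord x v))" by simp
    also have "\<dots> \<le> \<rho>' * (exp (r * t) * \<alpha> x (coord x v))"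
      using cone_\<alpha>_nonneg[OF \<rho> v] by (intro mult_right_mono contr j) simp
    finally show ?thesis by (simp only: \<alpha>_flow[OF vT])
  qed
  then show ?thesis using tangent_map_in[OF vT] by (simp add: cone_def)
qed

lemma continuous_on_deriv: "j \<in> I \<Longrightarrow> continuous_on UNIV (\<lambda>v. cmod (differential A (\<phi> j) x v))"
  unfolding differential_eq
  by (intro continuous_on_norm continuous_on_linear_coord linear_deriv)

lemma continuous_on_\<alpha>: "continuous_on UNIV (\<lambda>v. \<rho> * \<alpha> x (coord x v))"
  by (intro continuous_intros continuous_on_linear_coord linear_\<alpha>)

lemma cone_field_cone:
  assumes \<rho>: "\<rho> > 0" and "solid A (cone \<rho>)"
  shows "cone_field A (cone \<rho>)"
  unfolding cone_field_def
proof (intro conjI allI ballI impI)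
  show "solid A (cone \<rho>)" by fact
  fix x
  have "{v. \<forall>j\<in>I. cmod (differential A (\<phi> j) x v) \<le> \<rho> * \<alpha> x (coord x v)}
      = (\<Inter>j\<in>I. {v. cmod (differential A (\<phi> j) x v) \<le> \<rho> * \<alpha> x (coord x v)})" by auto
  also have "closed \<dots>"
    by (intro closed_INT ballI closed_Collect_le continuous_on_deriv continuous_on_\<alpha>)
  finally have "closedin (top_of_set (tangent_space A x))
      (tangent_space A x \<inter> {v. \<forall>j\<in>I. cmod (differential A (\<phi> j) x v) \<le> \<rho> * \<alpha> x (coord x v)})"
    by (rule closedin_closed_Int)
  then show "closedin (top_of_set (tangent_space A x)) (cone \<rho> x)"
    by (simp add: cone_def Int_def)
  show "v + w \<in> cone \<rho> x" if "v \<in> cone \<rho> x" "w \<in> cone \<rho> x" for v w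
  proof -
    have "cmod (coord_deriv (\<phi> j) x (coord x v + coord x w)) \<le> \<rho> * \<alpha> x (coord x v + coord x w)"
      if j: "j \<in> I" for j
    proof -
      have "cmod (coord_deriv (\<phi> j) x (coord x v + coord x w))
          \<le> cmod (coord_deriv (\<phi> j) x (coord x v)) + cmod (coord_deriv (\<phi> j) x (coord x w))"
        by (simp add: linear_add[OF linear_deriv[OF j]] norm_triangle_ineq)
      also have "\<dots> \<le> \<rho> * \<alpha> x (coord x v) + \<rho> * \<alpha> x (coord x w)"
        using j \<open>v \<in> _\<close> \<open>w \<in> _\<close> by (intro add_mono) (auto simp: cone_def differential_eq)
      finally show ?thesis by (simp add: linear_add[OF linear_\<alpha>] distrib_left)
    qed
    then show ?thesis using that by (simp add: cone_def tangent_space_lin differential_eq)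
  qed
  show "s *\<^sub>R v \<in> cone \<rho> x" if s: "0 < s" and v: "v \<in> cone \<rho> x" for s v
  proof -
    have "s * cmod (differential A (\<phi> j) x v) \<le> s * (\<rho> * \<alpha> x (coord x v))" if "j \<in> I" for j
      using that s v by (intro mult_left_mono) (auto simp: cone_def)
    then show ?thesis
      using s v by (simp add: cone_def tangent_space_lin differential_eq coord_lin
          linear_cmul[OF linear_\<alpha>] linear_cmul[OF linear_deriv] mult.left_commute)
  qed
  show "cone \<rho> x \<inter> uminus ` cone \<rho> x = {0}"
  proof
    show "{0} \<subseteq> cone \<rho> x \<inter> uminus ` cone \<rho> x"
      using zero_in_cone by (auto intro!: image_eqI[of _ _ 0])
    show "cone \<rho> x \<inter> uminus ` cone \<rho> x \<subseteq> {0}"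
    proof
      fix v assume "v \<in> cone \<rho> x \<inter> uminus ` cone \<rho> x"
      then obtain w where v: "v \<in> cone \<rho> x" and w: "w \<in> cone \<rho> x" "v = - w" by auto
      have "\<alpha> x (coord x v) = - \<alpha> x (coord x w)" by (simp add: w(2) linear_neg[OF linear_\<alpha>])
      then have "\<alpha> x (coord x v) = 0"
        using cone_\<alpha>_nonneg[OF \<rho> v] cone_\<alpha>_nonneg[OF \<rho> w(1)] by linarith
      then show "v \<in> {0}" using cone_zero_iff[OF v] by simp
    qed
  qed
qed

lemma interior_of_cone:
  assumes "v \<in> tangent_space A x" "\<And>j. j \<in> I \<Longrightarrow> cmod (differential A (\<phi> j) x v) < \<rho> * \<alpha> x (coord x v)"
  shows "v \<in> tangent_interior A x (cone \<rho> x)"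
proof -
  let ?V = "{v. \<forall>j\<in>I. cmod (differential A (\<phi> j) x v) < \<rho> * \<alpha> x (coord x v)}"
  have "?V = (\<Inter>j\<in>I. {v. cmod (differential A (\<phi> j) x v) < \<rho> * \<alpha> x (coord x v)})" by auto
  also have "open \<dots>"
    by (intro open_INT fin_I ballI open_Collect_less continuous_on_deriv continuous_on_\<alpha>)
  finally have "openin (top_of_set (tangent_space A x)) (tangent_space A x \<inter> ?V)" by (rule openin_open_Int)
  moreover have "v \<in> tangent_space A x \<inter> ?V" using assms by auto
  moreover have "tangent_space A x \<inter> ?V \<subseteq> cone \<rho> x" by (auto simp: cone_def intro: less_imp_le)
  ultimately show ?thesis unfolding tangent_interior_def interior_of_def by blast
qed

lemma differentially_positive_cone:
  assumes "solid A (cone 1)"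
  shows "differentially_positive A \<psi> (cone 1)"
  unfolding differentially_positive_def
proof (intro conjI allI impI subsetI)
  show "cone_field A (cone 1)" using assms by (intro cone_field_cone) auto
  fix x t w assume t: "0 < (t::real)" and "w \<in> tangent_map A (\<psi> t) x ` cone 1 x"
  then obtain v where v: "v \<in> cone 1 x" "w = tangent_map A (\<psi> t) x v" by auto
  show "w \<in> cone 1 (\<psi> t x)"
    unfolding v(2)
  proof (rule flow_contracts_cone[OF _ v(1)])
    show "exp ((Re (\<mu> j) - r) * t) * 1 \<le> 1" if "j \<in> I" for j
      using rate[OF that] t by (simp add: mult_nonpos_nonneg)
  qed simp
qed

end

locale strict_koopman_cone = koopman_cone A \<psi> \<phi> \<mu> J I r \<alpha>
  for A :: "('a::{t2_space, second_countable_topology}, 'n::finite) chart set"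
    and \<psi> :: "real \<Rightarrow> 'a \<Rightarrow> 'a" and \<phi> :: "'j \<Rightarrow> 'a \<Rightarrow> complex" and \<mu> :: "'j \<Rightarrow> complex" and J :: "'j set"
    and I :: "'j set" and r :: real and \<alpha> :: "'a \<Rightarrow> real^'n \<Rightarrow> real" +
  assumes gap: "j \<in> I \<Longrightarrow> Re (\<mu> j) < r" and solid_cone: "solid A (cone 1)"
begin

lemma contraction_tendsto: "j \<in> I \<Longrightarrow> ((\<lambda>t. exp ((Re (\<mu> j) - r) * t)) \<longlongrightarrow> 0) at_top"
  using gap[of j]
  by (intro filterlim_compose[OF exp_at_bot] filterlim_tendsto_neg_mult_at_bot[OF tendsto_const _ filterlim_ident]) simp

text \<open>Otherwise the \<open>b\<^sub>j\<close> alone would be jointly injective on the tangent space at \<open>y\<close>, and \<open>\<alpha>\<close> would be bounded by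
a fixed multiple of \<open>\<Sum>j. |b\<^sub>j|\<close>. But pushing forward a nonzero vector of the cone at \<open>\<psi> (- t) y\<close> yields a
vector at \<open>y\<close> with \<open>|b\<^sub>j| \<le> exp ((Re (\<mu> j) - r) * t) * \<alpha>\<close> and \<open>\<alpha> > 0\<close>, which is absurd for large \<open>t\<close>.\<close>

lemma centre_exists:
  obtains u where "\<alpha> y u = 1" "\<And>j. j \<in> I \<Longrightarrow> coord_deriv (\<phi> j) y u = 0"
proof -
  have "\<exists>u. \<alpha> y u \<noteq> 0 \<and> (\<forall>j\<in>I. coord_deriv (\<phi> j) y u = 0)"
  proof (rule ccontr)
    assume contra: "\<not> ?thesis"
    have inj: "u = 0" if "\<And>j. j \<in> I \<Longrightarrow> coord_deriv (\<phi> j) y u = 0" for u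
      using that contra by (intro definite[of y u]) blast+
    obtain M where M: "\<And>j. j \<in> I \<Longrightarrow> linear (M j)"
        "\<And>u. (\<Sum>j\<in>I. M j (coord_deriv (\<phi> j) y u)) = u"
      using joint_left_inverse[where D = "\<lambda>j. coord_deriv (\<phi> j) y", OF fin_I linear_deriv inj] by blast
    define C where "C j = onorm (\<lambda>w. \<alpha> y (M j w))" for j
    have bl: "bounded_linear (\<lambda>w. \<alpha> y (M j w))" if "j \<in> I" for j
      using linear_compose[OF M(1)[OF that] linear_\<alpha>[of y]] by (simp add: linear_conv_bounded_linear o_def)
    have "1 \<le> (\<Sum>j\<in>I. C j * exp ((Re (\<mu> j) - r) * t))" for t
    proof -
      let ?x = "\<psi> (- t) y"
      have "tangent_interior A ?x (cone 1 ?x) \<noteq> {}" using solid_cone by (simp add: solid_def)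
      then obtain w where w: "w \<in> cone 1 ?x" "w \<in> tangent_space A ?x" "w \<noteq> 0"
        by (rule nonzero_of_interior) (rule that)
      define v where "v = tangent_map A (\<psi> t) ?x w"
      have y: "\<psi> t ?x = y" by (rule flow_backward_forward)
      have "\<alpha> ?x (coord ?x w) > 0"
        using cone_\<alpha>_nonneg[OF _ w(1)] cone_zero_iff[OF w(1)] w(3) by (simp add: less_le)
      then have pos: "\<alpha> y (coord y v) > 0"
        using \<alpha>_flow[OF w(2), of t] by (simp add: y v_def)
      have D: "cmod (coord_deriv (\<phi> j) y (coord y v)) \<le> exp ((Re (\<mu> j) - r) * t) * \<alpha> y (coord y v)" if j: "j \<in> I" for j
      proof -
        have "cmod (differential A (\<phi> j) y v) = exp (Re (\<mu> j) * t) * cmod (differential A (\<phi> j) ?x w)"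
          using j I differential_tangent_map[OF w(2), of j t] by (simp add: y v_def norm_mult subset_iff)
        also have "\<dots> \<le> exp (Re (\<mu> j) * t) * \<alpha> ?x (coord ?x w)"
          using w(1) j by (intro mult_left_mono) (auto simp: cone_def)
        also have "exp (Re (\<mu> j) * t) = exp ((Re (\<mu> j) - r) * t) * exp (r * t)"
          by (simp add: mult_exp_exp algebra_simps)
        also have "\<dots> * \<alpha> ?x (coord ?x w) = exp ((Re (\<mu> j) - r) * t) * \<alpha> y (coord y v)"
          using \<alpha>_flow[OF w(2), of t] by (simp add: y v_def)
        finally show ?thesis by (simp add: differential_eq)
      qed
      have "\<alpha> y (coord y v) = (\<Sum>j\<in>I. \<alpha> y (M j (coord_deriv (\<phi> j) y (coord y v))))"
        using M(2)[of "coord y v"] by (simp flip: linear_sum[OF linear_\<alpha>])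
      also have "\<dots> \<le> (\<Sum>j\<in>I. C j * (exp ((Re (\<mu> j) - r) * t) * \<alpha> y (coord y v)))"
      proof (rule sum_mono)
        fix j assume j: "j \<in> I"
        let ?d = "coord_deriv (\<phi> j) y (coord y v)"
        have "\<alpha> y (M j ?d) \<le> norm (\<alpha> y (M j ?d))" by simp
        also have "\<dots> \<le> C j * cmod ?d" unfolding C_def by (rule onorm[OF bl[OF j]])
        also have "\<dots> \<le> C j * (exp ((Re (\<mu> j) - r) * t) * \<alpha> y (coord y v))"
          unfolding C_def by (intro mult_left_mono D j onorm_pos_le bl)
        finally show "\<alpha> y (M j ?d) \<le> \<dots>" .
      qed
      also have "\<dots> = (\<Sum>j\<in>I. C j * exp ((Re (\<mu> j) - r) * t)) * \<alpha> y (coord y v)"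
        by (simp add: sum_distrib_right mult.assoc)
      finally show ?thesis using pos by simp
    qed
    then have "\<forall>\<^sub>F t in at_top. 1 \<le> (\<Sum>j\<in>I. C j * exp ((Re (\<mu> j) - r) * t))" by simp
    moreover have "((\<lambda>t. \<Sum>j\<in>I. C j * exp ((Re (\<mu> j) - r) * t)) \<longlongrightarrow> (\<Sum>j\<in>I. C j * 0)) at_top"
      by (intro tendsto_sum tendsto_mult tendsto_const contraction_tendsto)
    ultimately have "1 \<le> (\<Sum>j\<in>I. C j * 0)"
      by (intro tendsto_lowerbound[OF _ _ trivial_limit_at_top_linorder])
    then show False by simp
  qed
  then obtain u where u: "\<alpha> y u \<noteq> 0" "\<And>j. j \<in> I \<Longrightarrow> coord_deriv (\<phi> j) y u = 0" by blast
  show thesis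
    using u by (intro that[of "(1 / \<alpha> y u) *\<^sub>R u"])
      (auto simp: linear_cmul[OF linear_\<alpha>] linear_cmul[OF linear_deriv])
qed

text \<open>The centre turns the cone, in coordinates, into a cone over the unit ball of a norm, so that the
equivalence theorem for such cones applies.\<close>

lemma norm_cone_at:
  obtains u where "norm_cone (\<alpha> x) (\<lambda>j. coord_deriv (\<phi> j) x) I u"
proof -
  obtain u where u: "\<alpha> x u = 1" "\<And>j. j \<in> I \<Longrightarrow> coord_deriv (\<phi> j) x u = 0" by (rule centre_exists) (rule that)
  then have "norm_cone (\<alpha> x) (\<lambda>j. coord_deriv (\<phi> j) x) I u"
    by (intro norm_cone.intro linear_\<alpha> linear_deriv fin_I I(2)) (assumption | erule definite | blast)+
  then show thesis by (rule that)
qed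

lemma cone_eq_norm_cone:
  "cone \<rho> x = tangent x ` norm_cone.cone (\<alpha> x) (\<lambda>j. coord_deriv (\<phi> j) x) I \<rho>"
proof -
  obtain u where "norm_cone (\<alpha> x) (\<lambda>j. coord_deriv (\<phi> j) x) I u" by (rule norm_cone_at)
  then interpret N: norm_cone "\<alpha> x" "\<lambda>j. coord_deriv (\<phi> j) x" I u .
  show ?thesis
  proof (intro equalityI subsetI)
    fix v assume v: "v \<in> cone \<rho> x"
    then have "v = tangent x (coord x v)" by (simp add: cone_def tangent_coord)
    moreover have "coord x v \<in> N.cone \<rho>" using v by (simp add: cone_def N.cone_def differential_eq)
    ultimately show "v \<in> tangent x ` N.cone \<rho>" by blast
  qed (auto simp: cone_def N.cone_def differential_eq coord_tangent tangent_in)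
qed

lemma cones_linearly_equivalent:
  assumes "linearly_equivalent_cones A {cone 1}"
  shows "linearly_equivalent_cones A {cone 1, cone \<rho>}"
  unfolding linearly_equivalent_cones_def
proof (intro allI)
  fix x y
  have "\<exists>L. tangent_iso A x y L \<and> L ` cone 1 x = cone 1 y"
    using assms by (simp add: linearly_equivalent_cones_def)
  then obtain L where L: "tangent_iso A x y L" "L ` cone 1 x = cone 1 y" by blast
  obtain u where "norm_cone (\<alpha> x) (\<lambda>j. coord_deriv (\<phi> j) x) I u" by (rule norm_cone_at)
  then interpret N: norm_cone "\<alpha> x" "\<lambda>j. coord_deriv (\<phi> j) x" I u .
  obtain w where "norm_cone (\<alpha> y) (\<lambda>j. coord_deriv (\<phi> j) y) I w" by (rule norm_cone_at)
  then interpret N': norm_cone "\<alpha> y" "\<lambda>j. coord_deriv (\<phi> j) y" I w .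
  have L_in: "L v \<in> tangent_space A y" if "v \<in> tangent_space A x" for v
    using L(1) that by (auto simp: tangent_iso_def bij_betw_def)
  define l where "l z = coord y (L (tangent x z))" for z
  have linl: "linear l"
    using L(1) by (intro linearI) (auto simp: l_def tangent_lin tangent_iso_def tangent_in scaleR_fun_def)
  have bij_tangent: "bij_betw (tangent x) UNIV (tangent_space A x)" for x
    by (rule bij_betw_byWitness[where f' = "coord x"]) (auto simp: coord_tangent tangent_coord tangent_in)
  have bij_coord: "bij_betw (coord x) (tangent_space A x) UNIV" for x
    by (rule bij_betw_byWitness[where f' = "tangent x"]) (auto simp: coord_tangent tangent_coord tangent_in)
  have "bij_betw L (tangent_space A x) (tangent_space A y)" using L(1) by (simp add: tangent_iso_def)
  then have bijl: "bij l"
    using bij_betw_trans[OF bij_betw_trans[OF bij_tangent] bij_coord] by (simp add: l_def[abs_def] o_def)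
  have "l ` N.cone 1 = coord y ` L ` cone 1 x"
    by (simp add: cone_eq_norm_cone image_image l_def)
  also have "\<dots> = N'.cone 1"
    unfolding L(2) by (simp add: cone_eq_norm_cone image_image coord_tangent)
  finally have l_cone: "l ` N.cone 1 = N'.cone 1" .
  obtain l' where l': "linear l'" "bij l'" "\<And>\<rho>. l' ` N.cone \<rho> = N'.cone \<rho>"
    using norm_cones_equivalent[OF N.norm_cone_axioms N'.norm_cone_axioms linl bijl l_cone] by blast
  define L' where "L' v = tangent y (l' (coord x v))" for v
  have "bij_betw L' (tangent_space A x) (tangent_space A y)"
    using bij_betw_trans[OF bij_betw_trans[OF bij_coord l'(2)] bij_tangent]
    by (simp add: L'_def[abs_def] o_def)
  then have "tangent_iso A x y L'"
    unfolding tangent_iso_def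
    by (auto simp: L'_def coord_lin linear_add[OF l'(1)] linear_cmul[OF l'(1)] tangent_lin)
  moreover have "L' ` cone \<rho> x = cone \<rho> y" for \<rho>
    by (simp add: L'_def cone_eq_norm_cone image_image coord_tangent flip: l'(3))
  ultimately show "\<exists>L. tangent_iso A x y L \<and> (\<forall>K\<in>{cone 1, cone \<rho>}. L ` K x = K y)" by blast
qed

lemma strictly_differentially_positive_cone: "strictly_differentially_positive A \<psi> (cone 1)"
proof -
  have "\<forall>\<^sub>F t in at_top. \<forall>j\<in>I. exp ((Re (\<mu> j) - r) * t) < 1 / 2"
    by (intro eventually_ball_finite fin_I ballI order_tendstoD(2)[OF contraction_tendsto]) auto
  then obtain T0 where T0: "\<And>t j. t \<ge> T0 \<Longrightarrow> j \<in> I \<Longrightarrow> exp ((Re (\<mu> j) - r) * t) < 1 / 2"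
    unfolding eventually_at_top_linorder by blast
  have "solid A (cone (1 / 2))"
    unfolding solid_def
  proof
    fix x
    obtain u where u: "\<alpha> x u = 1" "\<And>j. j \<in> I \<Longrightarrow> coord_deriv (\<phi> j) x u = 0" by (rule centre_exists) (rule that)
    have "tangent x u \<in> tangent_interior A x (cone (1 / 2) x)"
      using u by (intro interior_of_cone tangent_in) (simp add: differential_eq coord_tangent)
    then show "tangent_interior A x (cone (1 / 2) x) \<noteq> {}" by blast
  qed
  then have "cone_field A (cone (1 / 2))" by (intro cone_field_cone) auto
  moreover have "cone (1 / 2) x \<subseteq> tangent_interior A x (cone 1 x) \<union> {0}" for x
  proof
    fix v assume v: "v \<in> cone (1 / 2) x"
    show "v \<in> tangent_interior A x (cone 1 x) \<union> {0}"
    proof (cases "v = 0")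
      case False
      then have "\<alpha> x (coord x v) > 0"
        using cone_\<alpha>_nonneg[OF _ v] cone_zero_iff[OF v] by (simp add: less_le)
      then have "v \<in> tangent_interior A x (cone 1 x)"
        using v by (intro interior_of_cone) (fastforce simp: cone_def)+
      then show ?thesis by simp
    qed simp
  qed
  moreover have "tangent_map A (\<psi> t) x ` cone 1 x \<subseteq> cone (1 / 2) (\<psi> t x)" if t: "t \<ge> max 1 T0" for x t
  proof
    fix w assume "w \<in> tangent_map A (\<psi> t) x ` cone 1 x"
    then obtain v where v: "v \<in> cone 1 x" "w = tangent_map A (\<psi> t) x v" by auto
    show "w \<in> cone (1 / 2) (\<psi> t x)"
      unfolding v(2) using T0[of t] t by (intro flow_contracts_cone[OF _ v(1)]) (auto intro: less_imp_le)
  qed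
  ultimately show ?thesis
    unfolding strictly_differentially_positive_def
    using differentially_positive_cone[OF solid_cone] cones_linearly_equivalent[of "1 / 2"]
    by (intro conjI exI[of _ "max 1 T0"] exI[of _ "cone (1 / 2)"]) auto
qed

end

section \<open>The differential of the argument\<close>

context smooth_mfd
begin

text \<open>Differentiate \<open>g = \<rho> * exp (\<i> * \<theta>)\<close>; as the modulus \<open>\<rho>\<close> is constant, only the exponential contributes.\<close>

lemma coord_deriv_of_arg_lift:
  assumes g: "Ck_fun_on A 1 UNIV g" and const: "\<And>y. cmod (g y) = \<rho>"
    and lift: "arg_lift A g U \<theta>" and x: "x \<in> U"
  shows "coord_deriv g x u = \<i> * g x * of_real (coord_deriv \<theta> x u)"
proof -
  let ?c = "some_chart A x"
  let ?\<theta> = "\<theta> \<circ> chart_inv ?c"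
  have cx: "chart_inv ?c (snd ?c x) = x" by (rule chart_inv_chart[OF charts_atD[OF some_chart]])
  have U: "open U" and \<theta>: "Ck_fun_on A 1 U \<theta>" and polar: "\<And>y. y \<in> U \<Longrightarrow> g y = of_real \<rho> * cis (\<theta> y)"
    using lift by (auto simp: arg_lift_def const)
  have "(?\<theta> has_derivative coord_deriv \<theta> x) (at (snd ?c x))"
    by (rule has_derivative_coord_deriv[OF \<theta> x])
  then have "((\<lambda>z. \<i> * of_real (?\<theta> z)) has_derivative (\<lambda>u. \<i> * of_real (coord_deriv \<theta> x u))) (at (snd ?c x))"
    by (intro has_derivative_mult_right bounded_linear.has_derivative[OF bounded_linear_of_real])
  moreover have "(exp has_derivative (*) (exp (\<i> * of_real (?\<theta> (snd ?c x))))) (at (\<i> * of_real (?\<theta> (snd ?c x))))"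
    using DERIV_exp unfolding has_field_derivative_def .
  ultimately have "((\<lambda>z. exp (\<i> * of_real (?\<theta> z))) has_derivative
      (\<lambda>u. exp (\<i> * of_real (?\<theta> (snd ?c x))) * (\<i> * of_real (coord_deriv \<theta> x u)))) (at (snd ?c x))"
    by (rule has_derivative_compose)
  then have "((\<lambda>z. of_real \<rho> * exp (\<i> * of_real (?\<theta> z))) has_derivative
      (\<lambda>u. of_real \<rho> * (exp (\<i> * of_real (?\<theta> (snd ?c x))) * (\<i> * of_real (coord_deriv \<theta> x u))))) (at (snd ?c x))"
    by (rule has_derivative_mult_right)
  moreover have "\<forall>\<^sub>F z in nhds (snd ?c x). z \<in> snd ?c ` fst ?c \<and> chart_inv ?c z \<in> U"
    using U x by (intro eventually_chart_inv some_chart eventually_nhds_in_open)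
  then have "\<forall>\<^sub>F z in nhds (snd ?c x). of_real \<rho> * exp (\<i> * of_real (?\<theta> z)) = (g \<circ> chart_inv ?c) z"
    by eventually_elim (simp add: polar cis_conv_exp)
  then obtain S where "open S" "snd ?c x \<in> S"
    "\<And>z. z \<in> S \<Longrightarrow> of_real \<rho> * exp (\<i> * of_real (?\<theta> z)) = (g \<circ> chart_inv ?c) z"
    unfolding eventually_nhds by blast
  ultimately have "(g \<circ> chart_inv ?c has_derivative
      (\<lambda>u. of_real \<rho> * (exp (\<i> * of_real (?\<theta> (snd ?c x))) * (\<i> * of_real (coord_deriv \<theta> x u))))) (at (snd ?c x))"
    by (rule has_derivative_transform_within_open)
  from has_derivative_unique[OF has_derivative_coord_deriv[OF g UNIV_I] this]
  show ?thesis using polar[OF x] by (simp add: cx cis_conv_exp mult_ac)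
qed

text \<open>The differentials of all lifts coincide, because the differential of \<open>g\<close> determines them.\<close>

lemma differential_arg:
  assumes g: "Ck_fun_on A 1 UNIV g" and const: "\<And>y. cmod (g y) = \<rho>" and arg: "C1_arg A g"
  shows "differential_arg A g x v = Re (coord_deriv g x (coord x v) / (\<i> * g x))"
    and "coord_deriv g x u = \<i> * g x * of_real (Re (coord_deriv g x u / (\<i> * g x)))"
proof -
  have gx: "g x \<noteq> 0" using arg by (simp add: C1_arg_def)
  have eq: "coord_deriv \<theta> x u = Re (coord_deriv g x u / (\<i> * g x))"
    if "arg_lift A g U \<theta>" "x \<in> U" for U \<theta> u
    using gx by (simp add: coord_deriv_of_arg_lift[OF g const that])
  obtain U \<theta> where lift: "arg_lift A g U \<theta>" "x \<in> U" using arg unfolding C1_arg_def by blast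
  show "differential_arg A g x v = Re (coord_deriv g x (coord x v) / (\<i> * g x))"
    unfolding differential_arg_def
  proof (rule the_equality)
    show "\<exists>U \<theta>. x \<in> U \<and> arg_lift A g U \<theta> \<and> Re (coord_deriv g x (coord x v) / (\<i> * g x)) = differential A \<theta> x v"
      using lift eq[OF lift] by (intro exI[of _ U] exI[of _ \<theta>] conjI) (simp_all add: differential_eq)
    show "r = Re (coord_deriv g x (coord x v) / (\<i> * g x))"
      if "\<exists>U \<theta>. x \<in> U \<and> arg_lift A g U \<theta> \<and> r = differential A \<theta> x v" for r
      using that eq by (auto simp: differential_eq)
  qed
  show "coord_deriv g x u = \<i> * g x * of_real (Re (coord_deriv g x u / (\<i> * g x)))"
    using coord_deriv_of_arg_lift[OF g const lift, of u] eq[OF lift, of u] by simp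
qed

lemma coord_deriv_real:
  assumes g: "Ck_fun_on A 1 UNIV g" and real: "\<And>y. g y \<in> \<real>"
  shows "coord_deriv g x u = of_real (Re (coord_deriv g x u))"
proof -
  let ?c = "some_chart A x"
  have "((\<lambda>z. Im ((g \<circ> chart_inv ?c) z)) has_derivative (\<lambda>u. Im (coord_deriv g x u))) (at (snd ?c x))"
    by (rule bounded_linear.has_derivative[OF bounded_linear_Im has_derivative_coord_deriv[OF g UNIV_I]])
  moreover have "(\<lambda>z. Im ((g \<circ> chart_inv ?c) z)) = (\<lambda>z. 0)"
    using real by (simp add: fun_eq_iff complex_is_Real_iff)
  ultimately have "(\<lambda>u. Im (coord_deriv g x u)) = (\<lambda>u. 0)"
    using has_derivative_unique[OF _ has_derivative_const[of 0]] by metis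
  then show ?thesis by (simp add: complex_eq_iff fun_eq_iff)
qed

end

section \<open>Differential positivity\<close>

theorem proposition1:
  fixes A :: "('a::{t2_space, second_countable_topology}, 'n::finite) chart set"
    and m :: "'a \<Rightarrow> ('a, 'n) tvec \<Rightarrow> ('a, 'n) tvec \<Rightarrow> real"
    and f :: "'a \<Rightarrow> ('a, 'n) tvec"
    and \<psi> :: "real \<Rightarrow> 'a \<Rightarrow> 'a"
    and \<phi> :: "nat \<Rightarrow> 'a \<Rightarrow> complex"
    and \<mu> :: "nat \<Rightarrow> complex"
  assumes "CARD('n) \<ge> 2"
    and "smooth_manifold A"
    and "riemannian_metric A m"
    and "Ck_vector_field A 2 f"
    and "complete_flow A f \<psi>"
    and "\<forall>j\<in>{1..CARD('n)}. Ck_fun_on A 1 UNIV (\<phi> j)"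
    and "\<forall>j\<in>{1..CARD('n)}. koopman_eigenfunction \<psi> (\<mu> j) (\<phi> j)"
    and "\<forall>j\<in>{1..CARD('n)}. Re (\<mu> 1) \<ge> Re (\<mu> j)"
    and "\<forall>x. inj_on (\<lambda>v. \<lambda>j\<in>{1..CARD('n)}. differential A (\<phi> j) x v) (tangent_space A x)"
  shows "(\<mu> 1 \<in> \<real> \<and> (\<forall>x. \<phi> 1 x \<in> \<real>) \<and> solid A (real_cone A \<phi>) \<longrightarrow>
            differentially_positive A \<psi> (real_cone A \<phi>) \<and>
            ((\<forall>j\<in>{2..CARD('n)}. Re (\<mu> 1) > Re (\<mu> j)) \<longrightarrow>
               strictly_differentially_positive A \<psi> (real_cone A \<phi>)))
       \<and> (Re (\<mu> 1) = 0 \<and> C1_arg A (\<phi> 1) \<and> (\<exists>r. \<forall>x. cmod (\<phi> 1 x) = r) \<and>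
            solid A (arg_cone A \<phi>) \<longrightarrow>
            differentially_positive A \<psi> (arg_cone A \<phi>) \<and>
            ((\<forall>j\<in>{2..CARD('n)}. Re (\<mu> 1) > Re (\<mu> j)) \<longrightarrow>
               strictly_differentially_positive A \<psi> (arg_cone A \<phi>)))"
proof -
  let ?J = "{1..CARD('n)}" and ?I = "{2..CARD('n)}"
  interpret smooth_mfd A by unfold_locales fact
  have C1: "Ck_fun_on A 1 UNIV (\<phi> j)" if "j \<in> ?J" for j using assms(6) that by blast
  have eig: "\<phi> j (\<psi> t x) = exp (\<mu> j * of_real t) * \<phi> j x" if "j \<in> ?J" for j t x
    using assms(7) that unfolding koopman_eigenfunction_def koopman_def by (metis comp_apply)
  interpret koopman_flow A \<psi> \<phi> \<mu> ?J
  proof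
    show "\<psi> 0 x = x" "continuous_on UNIV (\<lambda>t. \<psi> t x)" for x
      using assms(5) by (simp_all add: complete_flow_def)
    show "v = 0" if v: "v \<in> tangent_space A x" and "\<And>j. j \<in> ?J \<Longrightarrow> differential A (\<phi> j) x v = 0" for v x
    proof -
      have "(\<lambda>j\<in>?J. differential A (\<phi> j) x v) = (\<lambda>j\<in>?J. differential A (\<phi> j) x 0)"
        using that by (auto simp: differential_eq linear_0[OF linear_coord_deriv[OF C1 UNIV_I]])
      then show ?thesis
        using assms(9) v tangent_space_lin(1) by (blast dest: inj_onD)
    qed
  qed (use C1 eig in auto)
  have one: "1 \<in> ?J" and I: "?I \<subseteq> ?J" "?I \<noteq> {}" and J: "?J = insert 1 ?I" using assms(1) by auto
  have definite: "u = 0" if "coord_deriv (\<phi> 1) x u = 0" "\<And>j. j \<in> ?I \<Longrightarrow> coord_deriv (\<phi> j) x u = 0" for x u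
  proof -
    have "tangent x u = 0"
      using that J by (intro immersion[where x = x] tangent_in) (auto simp: differential_eq coord_tangent)
    then show ?thesis using coord_tangent[of x u] by simp
  qed
  have flow: "coord_deriv (\<phi> 1) (\<psi> t x) (coord (\<psi> t x) (tangent_map A (\<psi> t) x v))
      = exp (\<mu> 1 * of_real t) * coord_deriv (\<phi> 1) x (coord x v)" if "v \<in> tangent_space A x" for v x t
    using differential_tangent_map[OF that one, of t] by (simp add: differential_eq)
  note lin = linear_coord_deriv[OF C1[OF one] UNIV_I]
  show ?thesis
  proof (intro conjI impI; elim conjE)
    assume real: "\<mu> 1 \<in> \<real>" "\<forall>x. \<phi> 1 x \<in> \<real>" and solid: "solid A (real_cone A \<phi>)"
    have \<mu>1: "\<mu> 1 = of_real (Re (\<mu> 1))" using real(1) by simp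
    define \<alpha> where "\<alpha> x u = Re (coord_deriv (\<phi> 1) x u)" for x u
    interpret koopman_cone A \<psi> \<phi> \<mu> ?J ?I "Re (\<mu> 1)" \<alpha>
    proof (intro koopman_cone.intro koopman_cone_axioms.intro koopman_flow_axioms)
      show "linear (\<alpha> x)" for x
        using linear_compose[OF lin bounded_linear.linear[OF bounded_linear_Re]] by (simp add: \<alpha>_def[abs_def] o_def)
      show "\<alpha> (\<psi> t x) (coord (\<psi> t x) (tangent_map A (\<psi> t) x v)) = exp (Re (\<mu> 1) * t) * \<alpha> x (coord x v)"
        if "v \<in> tangent_space A x" for v x t
      proof -
        have "exp (\<mu> 1 * of_real t) = of_real (exp (Re (\<mu> 1) * t))" by (subst \<mu>1) (simp flip: exp_of_real)
        then show ?thesis unfolding \<alpha>_def flow[OF that] by simp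
      qed
      show "u = 0" if "\<alpha> x u = 0" "\<And>j. j \<in> ?I \<Longrightarrow> coord_deriv (\<phi> j) x u = 0" for x u
        using that coord_deriv_real[OF C1[OF one], of x u] real(2) by (intro definite) (auto simp: \<alpha>_def)
    qed (use I assms(8) in auto)
    have K: "real_cone A \<phi> = cone 1"
      by (auto simp: fun_eq_iff real_cone_def cone_def \<alpha>_def differential_eq)
    show "differentially_positive A \<psi> (real_cone A \<phi>)"
      using solid unfolding K by (rule differentially_positive_cone)
    assume gap: "\<forall>j\<in>?I. Re (\<mu> j) < Re (\<mu> 1)"
    interpret strict_koopman_cone A \<psi> \<phi> \<mu> ?J ?I "Re (\<mu> 1)" \<alpha>
      using gap solid unfolding K by unfold_locales auto
    show "strictly_differentially_positive A \<psi> (real_cone A \<phi>)"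
      unfolding K by (rule strictly_differentially_positive_cone)
  next
    assume imag: "Re (\<mu> 1) = 0" and arg: "C1_arg A (\<phi> 1)" and "\<exists>r. \<forall>x. cmod (\<phi> 1 x) = r"
      and solid: "solid A (arg_cone A \<phi>)"
    then obtain \<rho> where \<rho>: "\<And>x. cmod (\<phi> 1 x) = \<rho>" by blast
    note dif = differential_arg[OF C1[OF one] \<rho> arg]
    define \<alpha> where "\<alpha> x u = Re (coord_deriv (\<phi> 1) x u / (\<i> * \<phi> 1 x))" for x u
    interpret koopman_cone A \<psi> \<phi> \<mu> ?J ?I "Re (\<mu> 1)" \<alpha>
    proof (intro koopman_cone.intro koopman_cone_axioms.intro koopman_flow_axioms)
      show "linear (\<alpha> x)" for x
        using linear_compose[OF lin bounded_linear.linear[OF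
              bounded_linear_compose[OF bounded_linear_Re bounded_linear_divide[of "\<i> * \<phi> 1 x"]]]]
        by (simp add: \<alpha>_def[abs_def] o_def)
      show "\<alpha> (\<psi> t x) (coord (\<psi> t x) (tangent_map A (\<psi> t) x v)) = exp (Re (\<mu> 1) * t) * \<alpha> x (coord x v)"
        if "v \<in> tangent_space A x" for v x t
        unfolding \<alpha>_def flow[OF that] eig[OF one] using imag by simp
      show "u = 0" if "\<alpha> x u = 0" "\<And>j. j \<in> ?I \<Longrightarrow> coord_deriv (\<phi> j) x u = 0" for x u
        using that dif(2)[of x u] by (intro definite) (auto simp: \<alpha>_def)
    qed (use I assms(8) in auto)
    have K: "arg_cone A \<phi> = cone 1"
      by (simp add: fun_eq_iff arg_cone_def cone_def \<alpha>_def dif(1) del: One_nat_def)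
    show "differentially_positive A \<psi> (arg_cone A \<phi>)"
      using solid unfolding K by (rule differentially_positive_cone)
    assume gap: "\<forall>j\<in>?I. Re (\<mu> j) < Re (\<mu> 1)"
    interpret strict_koopman_cone A \<psi> \<phi> \<mu> ?J ?I "Re (\<mu> 1)" \<alpha>
      using gap solid unfolding K by unfold_locales auto
    show "strictly_differentially_positive A \<psi> (arg_cone A \<phi>)"
      unfolding K by (rule strictly_differentially_positive_cone)
  qed
qed

end
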